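(* Let $N,n\in\mathbb N$ with $2\le n\le N$ and $Z=(z_{j,r})\in\mathbb C^{N\times n}$. Put $\widetilde z_r=\frac1N\sum_{j=1}^Nz_{j,r}$, $y_{u,v,r}=z_{u,r}-z_{v,r}$, $\widetilde p_R=\prod_{r\in R}\widetilde z_r$ for $R\subseteq[n]$, $$\widetilde p^{(2)}=\sum_{R\subseteq[n],\,|R|=2}\widetilde p_{[n]\setminus R}\sum_{j=1}^N\prod_{r\in R}(z_{j,r}-\widetilde z_r),\qquad \beta=\frac1n\sum_{r=1}^n|\widetilde z_r|^2.$$ If $n\ge3$ let $$\vartheta_3=\frac{(N-3)!}{N!}\sqrt{\frac{(n-3)!}{n!}}\Big(\sum_{(r,s,t)\in[n]^3_{\neq}}\Big(\sum_{(u,v,w)\in[N]^3_{\neq}}|y_{u,v,r}y_{u,v,s}y_{u,w,t}|\Big)^2\Big)^{1/2},$$ and if $n\ge4$ let $$\vartheta_4=\frac{(N-4)!}{N!}\sqrt{\frac{(n-4)!}{n!}}\Big(\sum_{(q,r,s,t)\in[n]^4_{\neq}}\Big(\sum_{(u,v,w,x)\in[N]^4_{\neq}}|y_{u,v,q}y_{u,v,r}y_{w,x,s}y_{w,x,t}|\Big)^2\Big)^{1/2};$$ set $\vartheta_3=0$ if $n=2$ and $\vartheta_4=0$ if $n\in\{2,3\}$. For $\nu\in\{3,4\}$ let $$\kappa^{(\nu)}=\begin{cases}\dfrac{1}{(n-\nu)(N-\nu)}\displaystyle\max_{J\subseteq[N],\,R\subseteq[n],\,|J|=|R|=\nu}\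 \sum_{j\in[N]\setminus J}\ \sum_{r\in[n]\setminus R}|z_{j,r}|^2,& n\ge\nu+1,\\ 1,& n\le\nu,\end{cases}$$ and for $x_1,x_2\in\mathbb R$ let $$f_n(x_1,x_2)=\sum_{k\in[n]\setminus[2]}(n+k-2)(n-k+1)x_1^{n-k}x_2^{k-3},\qquad g_n(x_1,x_2)=\sum_{k\in[n]\setminus[3]}(k-3)(n+k-2)(n-k+1)x_1^{n-k}x_2^{k-4}.$$ Then $$\Big|\frac{(N-n)!}{N!}\operatorname{Per}(Z)-\prod_{r=1}^n\widetilde z_r+\frac{\widetilde p^{(2)}}{N(N-1)}\Big|\le\frac{\vartheta_3}{2N^2}f_n\big(\sqrt\beta,\sqrt{\kappa^{(3)}}\big)+\frac{\vartheta_4}{8N^2}g_n\big(\sqrt\beta,\sqrt{\kappa^{(4)}}\big).$$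
   Context: $[m]=\{1,\dots,m\}$. For a set $A$ and $m\in\mathbb N$, $A^m_{\neq}$ denotes the set of $m$-tuples of pairwise distinct elements of $A$ (equivalently injective maps $[m]\to A$). $\operatorname{Per}(Z)=\sum_{j\in[N]^n_{\neq}}\prod_{r=1}^nz_{j_r,r}$. Empty sums are $0$, empty products are $1$, and $0^0=1$. *)

theory Defs
  imports "HOL-Analysis.Analysis"
begin

text \<open>
  An \<open>N \<times> n\<close> complex matrix is a function \<open>z :: nat \<Rightarrow> nat \<Rightarrow> complex\<close>; only the entries
  \<open>z j r\<close> with \<open>j \<in> {1..N}\<close> and \<open>r \<in> {1..n}\<close> are ever used.
\<close>

text \<open>The \<open>m\<close>-tuples \<open>(t 1, \<dots>, t m)\<close> of pairwise distinct elements of \<open>A\<close>, as extensional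
  functions on \<open>{1..m}\<close>, so that each tuple is counted exactly once in sums.\<close>

definition distinct_tuples :: "nat \<Rightarrow> 'a set \<Rightarrow> (nat \<Rightarrow> 'a) set" where
  "distinct_tuples m A = {t \<in> {1..m} \<rightarrow>\<^sub>E A. inj_on t {1..m}}"

definition Per :: "nat \<Rightarrow> nat \<Rightarrow> (nat \<Rightarrow> nat \<Rightarrow> complex) \<Rightarrow> complex" where
  "Per N n z = (\<Sum>j\<in>distinct_tuples n {1..N}. \<Prod>r\<in>{1..n}. z (j r) r)"

definition zmean :: "nat \<Rightarrow> (nat \<Rightarrow> nat \<Rightarrow> complex) \<Rightarrow> nat \<Rightarrow> complex" where
  "zmean N z r = (1 / of_nat N) * (\<Sum>j\<in>{1..N}. z j r)"

definition ydiff :: "(nat \<Rightarrow> nat \<Rightarrow> complex) \<Rightarrow> nat \<Rightarrow> nat \<Rightarrow> nat \<Rightarrow> complex" where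
  "ydiff z u v r = z u r - z v r"

definition pmean :: "nat \<Rightarrow> (nat \<Rightarrow> nat \<Rightarrow> complex) \<Rightarrow> nat set \<Rightarrow> complex" where
  "pmean N z R = (\<Prod>r\<in>R. zmean N z r)"

definition p2 :: "nat \<Rightarrow> nat \<Rightarrow> (nat \<Rightarrow> nat \<Rightarrow> complex) \<Rightarrow> complex" where
  "p2 N n z = (\<Sum>R\<in>{R. R \<subseteq> {1..n} \<and> card R = 2}.
     pmean N z ({1..n} - R) * (\<Sum>j\<in>{1..N}. \<Prod>r\<in>R. z j r - zmean N z r))"

definition beta :: "nat \<Rightarrow> nat \<Rightarrow> (nat \<Rightarrow> nat \<Rightarrow> complex) \<Rightarrow> real" where
  "beta N n z = (1 / real n) * (\<Sum>r\<in>{1..n}. (cmod (zmean N z r))\<^sup>2)"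

text \<open>In the next two definitions \<open>c\<close> is the tuple \<open>(r,s,t)\<close>, resp. \<open>(q,r,s,t)\<close>, of column
  indices and \<open>j\<close> is the tuple \<open>(u,v,w)\<close>, resp. \<open>(u,v,w,x)\<close>, of row indices.\<close>

definition theta3 :: "nat \<Rightarrow> nat \<Rightarrow> (nat \<Rightarrow> nat \<Rightarrow> complex) \<Rightarrow> real" where
  "theta3 N n z = (if n \<ge> 3 then
     fact (N - 3) / fact N * sqrt (fact (n - 3) / fact n) *
     sqrt (\<Sum>c\<in>distinct_tuples 3 {1..n}.
       (\<Sum>j\<in>distinct_tuples 3 {1..N}.
         cmod (ydiff z (j 1) (j 2) (c 1) * ydiff z (j 1) (j 2) (c 2) *
               ydiff z (j 1) (j 3) (c 3)))\<^sup>2)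
   else 0)"

definition theta4 :: "nat \<Rightarrow> nat \<Rightarrow> (nat \<Rightarrow> nat \<Rightarrow> complex) \<Rightarrow> real" where
  "theta4 N n z = (if n \<ge> 4 then
     fact (N - 4) / fact N * sqrt (fact (n - 4) / fact n) *
     sqrt (\<Sum>c\<in>distinct_tuples 4 {1..n}.
       (\<Sum>j\<in>distinct_tuples 4 {1..N}.
         cmod (ydiff z (j 1) (j 2) (c 1) * ydiff z (j 1) (j 2) (c 2) *
               ydiff z (j 3) (j 4) (c 3) * ydiff z (j 3) (j 4) (c 4)))\<^sup>2)
   else 0)"

text \<open>For \<open>\<nu> < n \<le> N\<close>, the case in which it matters, the maximum is over a finite nonempty set.\<close>

definition kappa :: "nat \<Rightarrow> nat \<Rightarrow> nat \<Rightarrow> (nat \<Rightarrow> nat \<Rightarrow> complex) \<Rightarrow> real" where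
  "kappa \<nu> N n z = (if n \<ge> \<nu> + 1 then
     1 / ((real n - real \<nu>) * (real N - real \<nu>)) *
     Max {\<Sum>j\<in>{1..N} - J. \<Sum>r\<in>{1..n} - R. (cmod (z j r))\<^sup>2 | J R.
       J \<subseteq> {1..N} \<and> R \<subseteq> {1..n} \<and> card J = \<nu> \<and> card R = \<nu>}
   else 1)"

text \<open>No natural-number subtraction truncates below, since \<open>k \<le> n\<close> and \<open>k \<ge> 3\<close> (resp. \<open>k \<ge> 4\<close>).\<close>

definition f_poly :: "nat \<Rightarrow> real \<Rightarrow> real \<Rightarrow> real" where
  "f_poly n x1 x2 = (\<Sum>k\<in>{1..n} - {1..2}.
     (real n + real k - 2) * (real n - real k + 1) * x1 ^ (n - k) * x2 ^ (k - 3))"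

definition g_poly :: "nat \<Rightarrow> real \<Rightarrow> real \<Rightarrow> real" where
  "g_poly n x1 x2 = (\<Sum>k\<in>{1..n} - {1..3}.
     (real k - 3) * (real n + real k - 2) * (real n - real k + 1) * x1 ^ (n - k) * x2 ^ (k - 4))"

end

theory Submission
  imports Defs
begin

text \<open>
  Everything is written as an average over uniformly random permutations \<open>p\<close> of the rows.
  Telescoping replaces the factors \<open>z (p k) k\<close> by their means one column at a time. As the mean of
  column \<open>k\<close> is the average of \<open>z (p i) k\<close> over all \<open>i\<close>, each difference becomes an average of
  \<open>z (p k) k - z (p i) k\<close>; this vanishes unless column \<open>i\<close> is already present, and then exchanging
  \<open>p i\<close> and \<open>p k\<close> produces a product of two entries of \<open>ydiff\<close>. A second telescoping of the
  factors that remain next to such a product leaves \<open>p2\<close> as main term, and remainders with three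
  factors on three rows or four factors on four rows.

  A remainder is bounded after averaging over a random order of the columns: the inequality of
  Carlen, Lieb and Loss bounds the permanent of the factors \<open>z (p l) l\<close>, and the Cauchy-Schwarz and
  Maclaurin inequalities turn the averages over columns into powers of \<open>kappa\<close> and \<open>beta\<close>.
\<close>

section \<open>Averages over permutations and Maclaurin's inequality\<close>

text \<open>Telescoping needs an order of the columns, so a single remainder singles out particular
  columns, whereas the claimed bound is symmetric in them. The left-hand side is invariant under
  permuting columns, so its bound may be averaged over all orders; this produces the sums over all
  column tuples. In such an average the weight on the three or four selected rows and columns is
  correlated with the remaining factors. With the selected part fixed, independent uniform
  permutations of the other rows and columns remain. There the entries of \<open>z\<close> are
  bounded uniformly in the selected part, which is why \<open>kappa\<close> is a maximum over
  deleted rows and columns. The factors \<open>zmean\<close> involve no rows, so their squares can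
  be averaged over all columns again, which is why \<open>beta\<close> deletes nothing.
  Cauchy-Schwarz is applied over columns only, so \<open>theta3\<close> and \<open>theta4\<close>
  are quadratic means over columns of plain averages over rows.\<close>

definition pavg :: "'a set \<Rightarrow> (('a \<Rightarrow> 'a) \<Rightarrow> 'b::real_normed_field) \<Rightarrow> 'b" where
  "pavg A H = (\<Sum>p | p permutes A. H p) / fact (card A)"

lemma pavg_cong:
  assumes "\<And>p. p permutes A \<Longrightarrow> G p = H p"
  shows "pavg A G = pavg A H"
  unfolding pavg_def using assms by (metis (mono_tags, lifting) mem_Collect_eq sum.cong)

lemma pavg_const [simp]:
  assumes "finite A"
  shows "pavg A (\<lambda>p. c) = c"
  using assms by (simp add: pavg_def card_permutations)

lemma pavg_add: "pavg A (\<lambda>p. G p + H p) = pavg A G + pavg A H"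
  by (simp add: pavg_def sum.distrib add_divide_distrib)

lemma pavg_diff: "pavg A (\<lambda>p. G p - H p) = pavg A G - pavg A H"
  by (simp add: pavg_def sum_subtractf diff_divide_distrib)

lemma pavg_cmult_left: "pavg A (\<lambda>p. c * H p) = c * pavg A H"
  by (simp add: pavg_def sum_distrib_left)

lemma pavg_cmult_right: "pavg A (\<lambda>p. H p * c) = pavg A H * c"
  by (simp add: pavg_def sum_distrib_right)

lemma pavg_sum: "pavg A (\<lambda>p. \<Sum>i\<in>I. H i p) = (\<Sum>i\<in>I. pavg A (H i))"
  unfolding pavg_def by (subst sum.swap) (simp add: sum_divide_distrib)

lemma pavg_mono:
  fixes G H :: "('a \<Rightarrow> 'a) \<Rightarrow> real"
  assumes "\<And>p. p permutes A \<Longrightarrow> G p \<le> H p"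
  shows "pavg A G \<le> pavg A H"
  unfolding pavg_def by (intro divide_right_mono sum_mono) (use assms in auto)

lemma pavg_nonneg:
  fixes H :: "('a \<Rightarrow> 'a) \<Rightarrow> real"
  assumes "\<And>p. p permutes A \<Longrightarrow> 0 \<le> H p"
  shows "0 \<le> pavg A H"
  unfolding pavg_def by (intro divide_nonneg_nonneg sum_nonneg) (use assms in auto)

lemma norm_pavg_le: "norm (pavg A H) \<le> pavg A (\<lambda>p. norm (H p))"
  by (simp add: pavg_def norm_divide divide_right_mono norm_sum)

lemma pavg_compose_right:
  assumes "q permutes A"
  shows "pavg A (\<lambda>p. H (p \<circ> q)) = pavg A H"
  unfolding pavg_def using sum_permutations_compose_right[OF assms, of H] by simp

lemma pavg_swap: "pavg A (\<lambda>p. pavg B (\<lambda>q. H p q)) = pavg B (\<lambda>q. pavg A (\<lambda>p. H p q))"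
  unfolding pavg_def sum_divide_distrib[symmetric]
  by (subst sum.swap) (simp add: mult.commute)

text \<open>Conditioning in disguise: right composition with a permutation of \<open>B\<close>
  preserves the uniform law, and a factor that sees \<open>p\<close> only outside \<open>B\<close>
  does not notice \<open>q\<close>.\<close>

lemma pavg_refine:
  assumes "finite A" "B \<subseteq> A"
  shows "pavg A H = pavg A (\<lambda>p. pavg B (\<lambda>q. H (p \<circ> q)))"
proof -
  have "pavg A (\<lambda>p. pavg B (\<lambda>q. H (p \<circ> q))) = pavg B (\<lambda>q. pavg A (\<lambda>p. H (p \<circ> q)))"
    by (rule pavg_swap)
  also have "\<dots> = pavg B (\<lambda>q. pavg A H)"
    by (intro pavg_cong pavg_compose_right permutes_subset[OF _ assms(2)])
  also have "\<dots> = pavg A H"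
    by (rule pavg_const) (use assms finite_subset in blast)
  finally show ?thesis by simp
qed

lemma pavg_cauchy_schwarz:
  fixes G H :: "('a \<Rightarrow> 'a) \<Rightarrow> real"
  shows "pavg A (\<lambda>p. G p * H p) \<le> sqrt (pavg A (\<lambda>p. (G p)\<^sup>2)) * sqrt (pavg A (\<lambda>p. (H p)\<^sup>2))"
proof -
  have "(\<Sum>p | p permutes A. G p * H p)
      \<le> sqrt (\<Sum>p | p permutes A. (G p)\<^sup>2) * sqrt (\<Sum>p | p permutes A. (H p)\<^sup>2)"
  proof -
    have "(\<Sum>p | p permutes A. G p * H p) \<le> (\<Sum>p | p permutes A. \<bar>G p\<bar> * \<bar>H p\<bar>)"
      by (intro sum_mono) (simp flip: abs_mult)
    also have "\<dots> \<le> L2_set G {p. p permutes A} * L2_set H {p. p permutes A}"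
      by (rule L2_set_mult_ineq)
    finally show ?thesis by (simp add: L2_set_def)
  qed
  then show ?thesis
    by (simp add: pavg_def real_sqrt_divide divide_right_mono flip: times_divide_times_eq)
qed

text \<open>Splits according to the image \<open>b\<close> of \<open>s\<close>: each permutation of
  \<open>insert s B\<close> is in a unique way a permutation of \<open>B\<close> followed by the
  transposition of \<open>s\<close> and \<open>b\<close>.\<close>

lemma pavg_insert:
  assumes "finite B" "s \<notin> B"
  shows "pavg (insert s B) H =
    (\<Sum>b\<in>insert s B. pavg B (\<lambda>q. H (Transposition.transpose s b \<circ> q))) / of_nat (card (insert s B))"
  using assms by (simp add: pavg_def sum_over_permutations_insert sum_divide_distrib[symmetric] add_divide_distrib mult.commute)

section \<open>The inequality behind Maclaurin's induction step\<close>

lemma power_diff_mult_diff_nonneg: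
  fixes u m :: real
  assumes "0 \<le> u" "0 \<le> m"
  shows "0 \<le> (u ^ k - m ^ k) * (u - m)"
proof (cases "u \<le> m")
  case True
  then show ?thesis using assms by (intro mult_nonpos_nonpos) (simp_all add: power_mono)
next
  case False
  then show ?thesis using assms by (intro mult_nonneg_nonneg) (simp_all add: power_mono)
qed

lemma am_gm_power:
  fixes u m :: real
  assumes "0 \<le> u" "0 \<le> m"
  shows "(real k + 1) * m * u ^ k \<le> real k * u ^ (k + 1) + m ^ (k + 1)"
proof (induction k)
  case (Suc k)
  have "0 \<le> (u ^ (k+1) - m ^ (k+1)) * (u - m)"
    using assms by (rule power_diff_mult_diff_nonneg)
  moreover have "u * ((real k + 1) * m * u ^ k) \<le> u * (real k * u ^ (k + 1) + m ^ (k + 1))"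
    using Suc assms by (intro mult_left_mono) auto
  ultimately show ?case by (simp add: algebra_simps)
qed simp

text \<open>With \<open>v b\<close> the mean of the other entries, each summand is a function of
  \<open>v b\<close> alone and lies below its tangent at the overall mean \<open>m\<close>. The
  \<open>v b\<close> have mean \<open>m\<close> as well, so the linear parts cancel in the
  sum.\<close>

lemma sum_mult_power_complement_le:
  fixes x :: "'a \<Rightarrow> real"
  assumes B: "finite B" "k < card B" and x: "\<And>b. b \<in> B \<Longrightarrow> 0 \<le> x b"
  defines "X \<equiv> \<Sum>b\<in>B. x b"
  shows "(\<Sum>b\<in>B. x b * ((X - x b) / (real (card B) - 1)) ^ k) \<le> real (card B) * (X / card B) ^ (k + 1)"
proof (cases "k = 0")
  case True
  then show ?thesis using B by (auto simp: X_def)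
next
  case False
  define N where "N = real (card B)"
  have N: "N > 1" "real k \<le> N - 1" using False B by (auto simp: N_def)
  define m where "m = X / N"
  define v where "v b = (X - x b) / (N - 1)" for b
  have m: "0 \<le> m" using x N by (auto simp: m_def X_def intro!: divide_nonneg_pos sum_nonneg)
  have v: "0 \<le> v b" if "b \<in> B" for b
    using that x N B member_le_sum[of b B x] by (auto simp: v_def X_def)
  have xv: "x b = N * m - (N - 1) * v b" for b using N by (simp add: m_def v_def field_simps)
  \<comment> \<open>Right side minus left side is \<open>N - 1 - k\<close> times the product
    \<open>(u ^ k - m ^ k) * (u - m)\<close> plus the gap in \<open>am_gm_power\<close>;
    \<open>k < card B\<close> makes the coefficient nonnegative.\<close>
  have tangent: "(N * m - (N - 1) * u) * u ^ k \<le> m ^ (k + 1) - (N - 1 - k) * m ^ k * (u - m)"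
    if u: "0 \<le> u" for u
  proof -
    have "0 \<le> (u ^ k - m ^ k) * (u - m)"
      using u m by (rule power_diff_mult_diff_nonneg)
    then have "0 \<le> (N - 1 - k) * ((u ^ k - m ^ k) * (u - m))"
      using N by simp
    moreover have "(real k + 1) * m * u ^ k \<le> real k * u ^ (k + 1) + m ^ (k + 1)"
      by (rule am_gm_power[OF u m])
    ultimately show ?thesis by (simp add: algebra_simps)
  qed
  have "(\<Sum>b\<in>B. x b * v b ^ k) \<le> (\<Sum>b\<in>B. m ^ (k + 1) - (N - 1 - k) * m ^ k * (v b - m))"
    by (intro sum_mono) (metis xv v tangent)
  also have "\<dots> = N * m ^ (k + 1) - (N - 1 - k) * m ^ k * (\<Sum>b\<in>B. v b - m)"
    by (simp add: sum_subtractf sum_distrib_left N_def right_diff_distrib)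
  also have "(\<Sum>b\<in>B. v b - m) = (\<Sum>b\<in>B. X - x b) / (N - 1) - N * m"
    by (subst sum_divide_distrib, subst sum_subtractf) (simp add: v_def N_def)
  also have "(\<Sum>b\<in>B. X - x b) = N * X - X"
    by (simp add: sum_subtractf N_def X_def)
  also have "(N * X - X) / (N - 1) - N * m = 0"
    using N by (simp add: m_def field_simps)
  finally show ?thesis by (simp add: v_def m_def N_def)
qed

text \<open>The average is the normalised elementary symmetric polynomial of degree \<open>card S\<close>, so this is
  Maclaurin's inequality.\<close>

lemma pavg_prod_le_mean_power:
  fixes x :: "'a \<Rightarrow> real"
  assumes "finite B" "S \<subseteq> B" "\<And>b. b \<in> B \<Longrightarrow> 0 \<le> x b"
  shows "pavg B (\<lambda>q. \<Prod>l\<in>S. x (q l)) \<le> ((\<Sum>b\<in>B. x b) / card B) ^ card S"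
proof -
  have "finite S" using assms finite_subset by blast
  then show ?thesis using assms
  proof (induction S arbitrary: B x rule: finite_induct)
    case empty
    then show ?case by simp
  next
    case (insert s S)
    define B' where "B' = B - {s}"
    have B': "finite B'" "s \<notin> B'" "B = insert s B'" "S \<subseteq> B'"
      using insert by (auto simp: B'_def)
    have N: "card B = Suc (card B')" using B' by simp
    define X where "X = (\<Sum>b\<in>B. x b)"
    have "pavg B (\<lambda>q. \<Prod>l\<in>insert s S. x (q l))
        = (\<Sum>b\<in>B. pavg B' (\<lambda>q. \<Prod>l\<in>insert s S. x ((Transposition.transpose s b \<circ> q) l))) / real (card B)"
      unfolding B'(3) by (rule pavg_insert) (use B' in auto)
    also have "\<dots> \<le> (\<Sum>b\<in>B. x b * ((X - x b) / (real (card B) - 1)) ^ card S) / real (card B)"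
    proof (intro divide_right_mono sum_mono)
      fix b assume b: "b \<in> B"
      \<comment> \<open>Once \<open>s\<close> is sent to \<open>b\<close>, the other places take
        values in \<open>B - {b}\<close>. The transposition relabels this set as \<open>B'\<close>,
        so the induction hypothesis is needed for a relabelled \<open>x\<close>.\<close>
      have tr: "Transposition.transpose s b c \<in> B" if "c \<in> B'" for c
        using that b B' by (auto simp: Transposition.transpose_def)
      have "pavg B' (\<lambda>q. \<Prod>l\<in>insert s S. x ((Transposition.transpose s b \<circ> q) l))
          = pavg B' (\<lambda>q. x b * (\<Prod>l\<in>S. (\<lambda>c. x (Transposition.transpose s b c)) (q l)))"
        using insert.hyps B'(2) by (intro pavg_cong) (simp add: permutes_not_in)
      also have "\<dots> = x b * pavg B' (\<lambda>q. \<Prod>l\<in>S. (\<lambda>c. x (Transposition.transpose s b c)) (q l))"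
        by (rule pavg_cmult_left)
      also have "\<dots> \<le> x b * ((\<Sum>c\<in>B'. x (Transposition.transpose s b c)) / card B') ^ card S"
        using insert.prems b tr B' by (intro mult_left_mono insert.IH) auto
      also have "(\<Sum>c\<in>B'. x (Transposition.transpose s b c)) = X - x b"
      proof -
        have "bij_betw (Transposition.transpose s b) B' (B - {b})"
          by (rule bij_betwI[where g = "Transposition.transpose s b"]) (use b B' in \<open>auto simp: Transposition.transpose_def split: if_splits\<close>)
        then have "(\<Sum>c\<in>B'. x (Transposition.transpose s b c)) = sum x (B - {b})"
          by (rule sum.reindex_bij_betw)
        then show ?thesis using b insert.prems by (simp add: X_def sum_diff1)
      qed
      finally show "pavg B' (\<lambda>q. \<Prod>l\<in>insert s S. x ((Transposition.transpose s b \<circ> q) l))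
          \<le> x b * ((X - x b) / (real (card B) - 1)) ^ card S"
        using N by simp
    qed auto
    also have "\<dots> \<le> real (card B) * (X / card B) ^ (card S + 1) / card B"
    proof (intro divide_right_mono)
      have "card S < card B" using N B' card_mono[of B' S] by linarith
      then show "(\<Sum>b\<in>B. x b * ((X - x b) / (real (card B) - 1)) ^ card S)
          \<le> real (card B) * (X / card B) ^ (card S + 1)"
        unfolding X_def by (intro sum_mult_power_complement_le) (use insert.prems in auto)
    qed auto
    also have "\<dots> = (X / card B) ^ card (insert s S)"
      using insert.hyps N by simp
    finally show ?case by (simp add: X_def)
  qed
qed

section \<open>A Hadamard-type inequality for permanents\<close>

text \<open>Tychonoff's theorem, once for each argument. All coordinates are confined, also those
  that the extremal problem never reads, since compactness refers to the full function
  space.\<close>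

lemma compact_box_fun2:
  fixes a b :: real
  shows "compact {h :: 'a \<Rightarrow> 'b \<Rightarrow> real. \<forall>l c. h l c \<in> {a..b}}"
proof -
  have 1: "compact (PiE UNIV (\<lambda>_. {a..b}) :: ('b \<Rightarrow> real) set)"
    using compactin_PiE[of "\<lambda>_. euclidean" "UNIV :: 'b set" "\<lambda>_. {a..b}"]
    by (simp add: euclidean_product_topology compactin_euclidean_iff)
  have "compact (PiE UNIV (\<lambda>_. PiE UNIV (\<lambda>_. {a..b})) :: ('a \<Rightarrow> 'b \<Rightarrow> real) set)"
    using compactin_PiE[of "\<lambda>_. euclidean" "UNIV :: 'a set" "\<lambda>_. PiE UNIV (\<lambda>_. {a..b}) :: ('b \<Rightarrow> real) set"] 1
    by (simp add: euclidean_product_topology compactin_euclidean_iff)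
  moreover have "PiE UNIV (\<lambda>_. PiE UNIV (\<lambda>_. {a..b})) = {h :: 'a \<Rightarrow> 'b \<Rightarrow> real. \<forall>l c. h l c \<in> {a..b}}"
    by (auto simp: PiE_def Pi_def)
  ultimately show ?thesis by simp
qed

lemma continuous_on_coordinate2:
  "continuous_on X (\<lambda>h :: 'a \<Rightarrow> 'b \<Rightarrow> real. h l c)"
  by (rule continuous_on_product_then_coordinatewise[OF continuous_on_product_then_coordinatewise[OF continuous_on_id]])

text \<open>The value of the permanent form is a symmetric bilinear function of any two of its arguments
  \<open>f\<close>, \<open>g\<close>. If \<open>(f, g)\<close> maximises it on the product of spheres, then so does the pair in which both
  entries are the normalisation of \<open>f + g\<close>, and its entries have a larger sum unless \<open>f = g\<close>.
  Hence some maximiser has all its arguments equal, where Maclaurin's inequality applies.\<close>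

lemma pavg_prod_le_one:
  fixes h0 :: "'a \<Rightarrow> 'a \<Rightarrow> real"
  assumes B: "finite B" "S \<subseteq> B" and h0: "\<And>l b. l \<in> S \<Longrightarrow> b \<in> B \<Longrightarrow> 0 \<le> h0 l b"
    and norm_h0: "\<And>l. l \<in> S \<Longrightarrow> (\<Sum>b\<in>B. (h0 l b)\<^sup>2) = card B"
  shows "pavg B (\<lambda>q. \<Prod>l\<in>S. h0 l (q l)) \<le> 1"
proof (cases "S = {}")
  case True
  then show ?thesis using B by simp
next
  case False
  have finS: "finite S" using B finite_subset by blast
  define N where "N = real (card B)"
  have "card B > 0" using False B card_gt_0_iff by blast
  then have N: "N \<ge> 1" by (simp add: N_def)
  define F where "F h = pavg B (\<lambda>q. \<Prod>l\<in>S. h l (q l))" for h :: "'a \<Rightarrow> 'a \<Rightarrow> real"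
  define L where "L h = (\<Sum>l\<in>S. \<Sum>b\<in>B. h l b)" for h :: "'a \<Rightarrow> 'a \<Rightarrow> real"
  define Q where "Q x = (\<Sum>b\<in>B. (x b)\<^sup>2)" for x :: "'a \<Rightarrow> real"
  \<comment> \<open>The box contains every nonnegative vector with \<open>Q x = N\<close> once it is
    cut to \<open>B\<close>, because \<open>(x b)^2 \<le> N \<le> N^2\<close>. Setting the
    irrelevant coordinates to 0 by \<open>cut\<close> keeps modified maximisers inside
    \<open>K\<close>.\<close>
  define K where "K = {h. (\<forall>l c. h l c \<in> {0..N}) \<and> (\<forall>l\<in>S. Q (h l) = N)}"
  define cut where "cut x b = (if b \<in> B then x b else 0)" for x :: "'a \<Rightarrow> real" and b
  have Fcong: "F h = F h'" if "\<And>l b. l \<in> S \<Longrightarrow> b \<in> B \<Longrightarrow> h l b = h' l b" for h h'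
    unfolding F_def using B(2) that
    by (intro pavg_cong prod.cong) (auto simp: permutes_in_image subset_iff)
  have bound: "cut x b \<in> {0..N}" if "\<And>b. b \<in> B \<Longrightarrow> 0 \<le> x b" "Q x = N" for x b
  proof (cases "b \<in> B")
    case True
    have "(x b)\<^sup>2 \<le> N"
      using member_le_sum[of b B "\<lambda>b. (x b)\<^sup>2"] B True that by (simp add: Q_def)
    also have "N \<le> N\<^sup>2" using N by (simp add: power2_eq_square)
    finally have "x b \<le> N" using N power2_le_imp_le[of "x b" N] by simp
    then show ?thesis using that True by (simp add: cut_def)
  qed (use N in \<open>simp add: cut_def\<close>)
  have Qcut: "Q (cut x) = Q x" for x by (simp add: Q_def cut_def)
  have contF: "continuous_on X F" for X
    unfolding F_def pavg_def by (intro continuous_intros continuous_on_coordinate2) simp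
  have contL: "continuous_on X L" for X
    unfolding L_def by (intro continuous_intros continuous_on_coordinate2)
  have "closed {h :: 'a \<Rightarrow> 'a \<Rightarrow> real. \<forall>l\<in>S. Q (h l) = N}"
  proof -
    have "closed (\<Inter>l\<in>S. {h :: 'a \<Rightarrow> 'a \<Rightarrow> real. Q (h l) = N})"
      unfolding Q_def by (intro closed_INT ballI closed_Collect_eq continuous_intros continuous_on_coordinate2)
    moreover have "(\<Inter>l\<in>S. {h. Q (h l) = N}) = {h. \<forall>l\<in>S. Q (h l) = N}" by auto
    ultimately show ?thesis by simp
  qed
  then have compK: "compact K"
    unfolding K_def Collect_conj_eq by (intro compact_Int_closed compact_box_fun2)
  have h0K: "(\<lambda>l. if l \<in> S then cut (h0 l) else (\<lambda>_. 0)) \<in> K"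
    using bound[OF h0] norm_h0 N by (auto simp: K_def Qcut) (auto simp: Q_def N_def)
  then obtain hm where hm: "hm \<in> K" "\<And>h. h \<in> K \<Longrightarrow> F h \<le> F hm"
    using continuous_attains_sup[OF compK _ contF] by blast
  define M where "M = F hm"
  \<comment> \<open>A second maximisation, of \<open>L\<close> over the compact set of maximisers of
    \<open>F\<close>, serves as tie-breaker.\<close>
  have "compact (K \<inter> {h. F h = M})"
    by (intro compact_Int_closed compK closed_Collect_eq contF continuous_on_const)
  moreover have "K \<inter> {h. F h = M} \<noteq> {}" using hm by (auto simp: M_def)
  ultimately have "\<exists>h\<in>K \<inter> {h. F h = M}. \<forall>h'\<in>K \<inter> {h. F h = M}. L h' \<le> L h"
    by (intro continuous_attains_sup contL)
  then obtain h where h: "h \<in> K" "F h = M" and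
      Lmax: "\<And>h'. h' \<in> K \<Longrightarrow> F h' = M \<Longrightarrow> L h' \<le> L h"
    by blast
  have Mmax: "F h' \<le> M" if "h' \<in> K" for h' using hm that by (simp add: M_def)
  have hnn: "0 \<le> h l b" for l b using h by (simp add: K_def)
  have equal: "h a b = h c b" if a: "a \<in> S" and c: "c \<in> S" and b: "b \<in> B" for a b c
  proof (rule ccontr)
    assume ne: "h a b \<noteq> h c b"
    then have ac: "a \<noteq> c" by auto
    have ac_split: "S = insert a (insert c (S - {a, c}))" using a c by blast
    define f g where "f = h a" and "g = h c"
    have Qfg: "Q f = N" "Q g = N" using h a c by (simp_all add: K_def f_def g_def)
    define R where "R q = (\<Prod>l\<in>S - {a, c}. h l (q l))" for q
    have Rnn: "0 \<le> R q" for q unfolding R_def by (intro prod_nonneg) (simp add: hnn)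
    define G where "G x y = pavg B (\<lambda>q. x (q a) * y (q c) * R q)" for x y
    have FG: "F (h(a := x, c := y)) = G x y" for x y
    proof -
      have "(\<Prod>l\<in>S. (h(a := x, c := y)) l (q l)) = x (q a) * y (q c) * R q" for q
      proof -
        have "(\<Prod>l\<in>S - {a, c}. (h(a := x, c := y)) l (q l)) = R q"
          unfolding R_def by (intro prod.cong) auto
        then show ?thesis
          by (subst ac_split) (simp add: finS ac mult.assoc)
      qed
      then show ?thesis by (simp add: F_def G_def)
    qed
    have Gsym: "G x y = G y x" for x y
    proof -
      have "Transposition.transpose a c permutes B" using a c B by (intro permutes_swap_id) auto
      then have "G x y = pavg B (\<lambda>q. x ((q \<circ> Transposition.transpose a c) a)
          * y ((q \<circ> Transposition.transpose a c) c) * R (q \<circ> Transposition.transpose a c))"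
        unfolding G_def by (rule pavg_compose_right[symmetric])
      also have "\<dots> = G y x"
        unfolding G_def by (intro pavg_cong) (auto simp: R_def transpose_apply_other intro!: prod.cong)
      finally show ?thesis .
    qed
    have Gadd: "G (\<lambda>b. x b + t * x' b) (\<lambda>b. x b + t * x' b) = G x x + 2 * t * G x x' + t\<^sup>2 * G x' x'" for x x' t
    proof -
      have "G (\<lambda>b. x b + t * x' b) (\<lambda>b. x b + t * x' b) = G x x + t * G x x' + t * G x' x + t\<^sup>2 * G x' x'"
        unfolding G_def pavg_add[symmetric] pavg_cmult_left[symmetric]
        by (intro pavg_cong) (simp add: algebra_simps power2_eq_square)
      then show ?thesis using Gsym[of x' x] by simp
    qed
    have Gscale: "G (\<lambda>b. t * x b) (\<lambda>b. t * x b) = t\<^sup>2 * G x x" for t x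
      unfolding G_def pavg_cmult_left[symmetric]
      by (intro pavg_cong) (simp add: algebra_simps power2_eq_square)
    have pin: "q a \<in> B" "q c \<in> B" if "q permutes B" for q
      using that a c B permutes_in_image[OF that] by auto
    have updK: "h(a := cut x, c := cut x) \<in> K" if "\<And>b. b \<in> B \<Longrightarrow> 0 \<le> x b" "Q x = N" for x
      using h that bound[OF that] by (auto simp: K_def Qcut)
    have Gcut: "G (cut x) (cut x) = G x x" for x
      unfolding G_def by (intro pavg_cong) (simp add: cut_def pin)
    have Gmax: "G x x \<le> M" if "\<And>b. b \<in> B \<Longrightarrow> 0 \<le> x b" "Q x = N" for x
      using Mmax[OF updK[OF that]] by (simp add: FG Gcut)
    \<comment> \<open>The weights \<open>R q\<close> are nonnegative, so passing to absolute values
      can only increase the form. Hence \<open>M\<close> controls it on signed vectors too, which is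
      needed for \<open>f - g\<close>.\<close>
    have Gbound: "\<bar>G x x\<bar> \<le> M * Q x / N" for x
    proof (cases "Q x = 0")
      case True
      then have "\<forall>b\<in>B. x b = 0" using B by (simp add: Q_def sum_nonneg_eq_0_iff)
      then have "G x x = pavg B (\<lambda>q. 0)" unfolding G_def by (intro pavg_cong) (simp add: pin)
      then show ?thesis using True B by simp
    next
      case False
      then have pos: "Q x > 0" by (simp add: Q_def sum_nonneg order_less_le)
      define t where "t = sqrt (N / Q x)"
      have t2: "t\<^sup>2 = N / Q x" using pos N by (simp add: t_def)
      have "Q (\<lambda>b. t * \<bar>x b\<bar>) = t\<^sup>2 * Q x"
        by (simp add: Q_def power_mult_distrib sum_distrib_left)
      then have "Q (\<lambda>b. t * \<bar>x b\<bar>) = N" using pos by (simp add: t2)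
      then have "G (\<lambda>b. t * \<bar>x b\<bar>) (\<lambda>b. t * \<bar>x b\<bar>) \<le> M"
        using pos N by (intro Gmax) (auto simp: t_def)
      then have "N / Q x * G (\<lambda>b. \<bar>x b\<bar>) (\<lambda>b. \<bar>x b\<bar>) \<le> M"
        by (simp add: Gscale t2)
      then have *: "G (\<lambda>b. \<bar>x b\<bar>) (\<lambda>b. \<bar>x b\<bar>) \<le> M * Q x / N"
        using pos N by (simp add: field_simps)
      have "\<bar>G x x\<bar> \<le> pavg B (\<lambda>q. norm (x (q a) * x (q c) * R q))"
        unfolding G_def using norm_pavg_le[of B "\<lambda>q. x (q a) * x (q c) * R q"] by simp
      also have "\<dots> = G (\<lambda>b. \<bar>x b\<bar>) (\<lambda>b. \<bar>x b\<bar>)"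
        unfolding G_def by (intro pavg_cong) (simp add: abs_mult Rnn)
      finally show ?thesis using * by simp
    qed
    have GM: "G f g = M" using FG[of f g] h by (simp add: f_def g_def)
    define d where "d = Q (\<lambda>b. f b + g b)"
    have para: "Q (\<lambda>b. f b - g b) + d = 4 * N"
    proof -
      have "Q (\<lambda>b. f b - g b) + d = 2 * Q f + 2 * Q g"
        by (simp add: Q_def d_def power2_sum power2_diff sum.distrib sum_subtractf sum_distrib_left algebra_simps)
      then show ?thesis using Qfg by simp
    qed
    have "Q (\<lambda>b. f b - g b) > 0"
      unfolding Q_def by (rule sum_pos2[OF B(1) b]) (use ne in \<open>auto simp: f_def g_def\<close>)
    then have dlt: "d < 4 * N" using para by simp
    have "Q f \<le> d" unfolding Q_def d_def
      by (intro sum_mono power_mono) (auto simp: f_def g_def hnn)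
    then have dpos: "d > 0" using Qfg N by simp
    \<comment> \<open>Polarisation: the values of the form at \<open>f + g\<close> and
      \<open>f - g\<close> differ by \<open>4 * M\<close>. The lower bound at \<open>f - g\<close>,
      combined with the parallelogram law, becomes a lower bound at \<open>f + g\<close>.\<close>
    have "G (\<lambda>b. f b + 1 * g b) (\<lambda>b. f b + 1 * g b) = G f f + G g g + 2 * M"
      unfolding Gadd by (simp add: GM)
    moreover have "G (\<lambda>b. f b + (-1) * g b) (\<lambda>b. f b + (-1) * g b) = G f f + G g g - 2 * M"
      unfolding Gadd by (simp add: GM)
    moreover have "- (M * Q (\<lambda>b. f b - g b) / N) \<le> G (\<lambda>b. f b - g b) (\<lambda>b. f b - g b)"
      using Gbound[of "\<lambda>b. f b - g b"] by linarith
    moreover have "Q (\<lambda>b. f b - g b) = 4 * N - d" using para by simp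
    moreover have "M * (4 * N - d) / N = 4 * M - M * d / N" using N by (simp add: field_simps)
    ultimately have Gfg: "M * d / N \<le> G (\<lambda>b. f b + g b) (\<lambda>b. f b + g b)" by simp
    define t where "t = sqrt (N / d)"
    have t2: "t\<^sup>2 = N / d" using dpos N by (simp add: t_def)
    \<comment> \<open>Strictness comes from \<open>f \<noteq> g\<close>. Replacing both arguments by
      \<open>e\<close> multiplies their total sum by \<open>2 * t > 1\<close>, which contradicts the
      maximality of \<open>L\<close>.\<close>
    have "sqrt (1 / 4) < t"
      unfolding t_def using dlt dpos N by (intro real_sqrt_less_mono) (simp add: field_simps)
    then have t: "t > 1 / 2" by (simp add: real_sqrt_divide)
    define e where "e b = t * (f b + g b)" for b
    have e0: "0 \<le> e b" for b using t by (simp add: e_def f_def g_def hnn)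
    have "Q e = t\<^sup>2 * d" by (simp add: Q_def e_def d_def power_mult_distrib sum_distrib_left)
    then have eQ: "Q e = N" using dpos by (simp add: t2)
    have "G e e = t\<^sup>2 * G (\<lambda>b. f b + g b) (\<lambda>b. f b + g b)" unfolding e_def Gscale ..
    also have "\<dots> \<ge> t\<^sup>2 * (M * d / N)" by (intro mult_left_mono Gfg) simp
    also have "t\<^sup>2 * (M * d / N) = M" using dpos N by (simp add: t2)
    finally have "M \<le> G e e" .
    then have "G e e = M" using Gmax[OF e0 eQ] by simp
    then have "L (h(a := cut e, c := cut e)) \<le> L h"
      using updK[OF e0 eQ] by (intro Lmax) (simp_all add: FG Gcut)
    moreover have "L h' = (\<Sum>b\<in>B. h' a b) + (\<Sum>b\<in>B. h' c b) + (\<Sum>l\<in>S - {a, c}. \<Sum>b\<in>B. h' l b)" for h'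
      unfolding L_def by (subst ac_split) (simp add: finS ac add.assoc)
    ultimately have "2 * (\<Sum>b\<in>B. e b) \<le> (\<Sum>b\<in>B. f b) + (\<Sum>b\<in>B. g b)"
      using ac by (simp add: f_def g_def cut_def)
    also have "2 * (\<Sum>b\<in>B. e b) = 2 * t * (\<Sum>b\<in>B. f b + g b)"
      by (simp add: e_def sum_distrib_left mult.assoc)
    finally have "2 * t * (\<Sum>b\<in>B. f b + g b) \<le> 1 * (\<Sum>b\<in>B. f b + g b)" by (simp add: sum.distrib)
    moreover have "(\<Sum>b\<in>B. f b + g b) > 0"
    proof (rule sum_pos2[OF B(1) b])
      show "f b + g b > 0"
        using ne hnn[of a b] hnn[of c b] unfolding f_def g_def by linarith
    qed (simp add: f_def g_def hnn)
    ultimately show False using t by simp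
  qed
  obtain s where s: "s \<in> S" using False by auto
  have "F h = F (\<lambda>_. h s)" by (intro Fcong) (rule equal[OF _ s])
  also have "\<dots> \<le> ((\<Sum>b\<in>B. h s b) / card B) ^ card S"
    unfolding F_def by (rule pavg_prod_le_mean_power) (use B hnn in auto)
  also have "\<dots> \<le> 1"
  proof (rule power_le_one)
    have "(\<Sum>b\<in>B. h s b) \<le> (\<Sum>b\<in>B. ((h s b)\<^sup>2 + 1) / 2)"
    proof (rule sum_mono)
      fix b show "h s b \<le> ((h s b)\<^sup>2 + 1) / 2"
        using zero_le_power2[of "h s b - 1"] by (simp add: power2_diff)
    qed
    also have "\<dots> = (Q (h s) + N) / 2"
      by (simp add: Q_def N_def sum_divide_distrib[symmetric] sum.distrib)
    also have "\<dots> = N" using h s by (simp add: K_def)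
    finally show "(\<Sum>b\<in>B. h s b) / card B \<le> 1" using N by (simp add: N_def)
  qed (simp add: sum_nonneg hnn)
  finally have "M \<le> 1" using h by simp
  moreover have "F h0 = F (\<lambda>l. if l \<in> S then cut (h0 l) else (\<lambda>_. 0))"
    by (intro Fcong) (simp add: cut_def)
  ultimately show ?thesis using Mmax[OF h0K] by (simp add: F_def)
qed

text \<open>The Hadamard-type inequality for permanents of Carlen, Lieb and Loss.\<close>

lemma pavg_prod_le_prod_l2:
  fixes h :: "'a \<Rightarrow> 'a \<Rightarrow> real"
  assumes B: "finite B" "S \<subseteq> B" and h: "\<And>l b. l \<in> S \<Longrightarrow> b \<in> B \<Longrightarrow> 0 \<le> h l b"
  shows "pavg B (\<lambda>q. \<Prod>l\<in>S. h l (q l)) \<le> (\<Prod>l\<in>S. sqrt ((\<Sum>b\<in>B. (h l b)\<^sup>2) / card B))"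
proof -
  define c where "c l = sqrt ((\<Sum>b\<in>B. (h l b)\<^sup>2) / card B)" for l
  have finS: "finite S" using B finite_subset by blast
  \<comment> \<open>Normalising by \<open>c l\<close> needs nonzero root mean squares. If some
    \<open>c l\<close> is 0, that factor vanishes on all of \<open>B\<close>, and so does the
    average.\<close>
  show ?thesis
  proof (cases "\<exists>l\<in>S. c l = 0")
    case True
    then obtain l where l: "l \<in> S" "c l = 0" by blast
    then have "card B \<noteq> 0" using B by auto
    then have "(\<Sum>b\<in>B. (h l b)\<^sup>2) = 0" using l by (simp add: c_def)
    then have z: "\<forall>b\<in>B. h l b = 0" using B by (simp add: sum_nonneg_eq_0_iff)
    have "pavg B (\<lambda>q. \<Prod>l\<in>S. h l (q l)) = pavg B (\<lambda>q. 0)"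
    proof (rule pavg_cong)
      fix q assume "q permutes B"
      then have "q l \<in> B" using l B permutes_in_image[of q B l] by auto
      then show "(\<Prod>l\<in>S. h l (q l)) = 0" using z l finS by (intro prod_zero) auto
    qed
    also have "\<dots> = 0" using B by simp
    also have "0 \<le> (\<Prod>l\<in>S. c l)" by (intro prod_nonneg) (simp add: c_def sum_nonneg)
    finally show ?thesis by (simp add: c_def)
  next
    case False
    have "c l \<ge> 0" for l by (simp add: c_def sum_nonneg)
    then have c: "c l > 0" if "l \<in> S" for l
      using that False by (simp add: order_less_le)
    have "pavg B (\<lambda>q. \<Prod>l\<in>S. h l (q l) / c l) \<le> 1"
    proof (rule pavg_prod_le_one[OF B])
      fix l assume l: "l \<in> S"
      then have N: "card B \<noteq> 0" using B by auto
      have "(c l)\<^sup>2 = (\<Sum>b\<in>B. (h l b)\<^sup>2) / card B" by (simp add: c_def sum_nonneg)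
      then have "(\<Sum>b\<in>B. (h l b)\<^sup>2) = card B * (c l)\<^sup>2" using N by simp
      then show "(\<Sum>b\<in>B. (h l b / c l)\<^sup>2) = card B"
        using c[OF l] by (simp add: power_divide sum_divide_distrib[symmetric])
    qed (use h c in \<open>auto intro!: divide_nonneg_pos\<close>)
    also have "pavg B (\<lambda>q. \<Prod>l\<in>S. h l (q l) / c l) = pavg B (\<lambda>q. \<Prod>l\<in>S. h l (q l)) * (1 / (\<Prod>l\<in>S. c l))"
      unfolding pavg_cmult_right[symmetric] by (simp add: prod_dividef)
    finally show ?thesis using c by (simp add: c_def[symmetric] field_simps prod_pos)
  qed
qed

section \<open>Averaging the remainders over rows and columns\<close>

lemma ex_permutes_extending:
  assumes A: "finite A" and C: "C \<subseteq> A" and f: "inj_on f C" "f ` C \<subseteq> A"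
  obtains p where "p permutes A" "\<And>x. x \<in> C \<Longrightarrow> p x = f x"
proof -
  have "card (A - C) = card (A - f ` C)"
    using assms by (simp add: card_Diff_subset finite_subset card_image)
  then obtain e where e: "bij_betw e (A - C) (A - f ` C)"
    using A finite_same_card_bij[of "A - C" "A - f ` C"] by auto
  define p where "p x = (if x \<in> C then f x else if x \<in> A then e x else x)" for x
  have "bij_betw p C (f ` C)"
    using f(1) by (simp add: p_def bij_betw_def cong: inj_on_cong image_cong_simp)
  moreover have "bij_betw p (A - C) (A - f ` C)"
    using e by (rule bij_betw_cong[THEN iffD1, rotated]) (simp add: p_def)
  ultimately have "bij_betw p (C \<union> (A - C)) (f ` C \<union> (A - f ` C))"
    by (rule bij_betw_combine) auto
  moreover have "C \<union> (A - C) = A" "f ` C \<union> (A - f ` C) = A" using C f(2) by auto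
  ultimately have "p permutes A"
    using C by (intro bij_imp_permutes) (auto simp: p_def)
  then show ?thesis by (rule that) (simp add: p_def)
qed

lemma finite_distinct_tuples [simp]: "finite A \<Longrightarrow> finite (distinct_tuples m A)"
  unfolding distinct_tuples_def
  by (rule finite_subset[of _ "{1..m} \<rightarrow>\<^sub>E A"]) (auto intro: finite_PiE)

text \<open>The values of \<open>p\<close> at \<open>m\<close> distinct places form a uniform
  distinct tuple: the permutations with prescribed values there are a left coset of those fixing the
  places, so every fibre has \<open>fact (card A - m)\<close> elements. This links averages to the
  sums in \<open>Per\<close>, \<open>theta3\<close> and \<open>theta4\<close>.\<close>

lemma pavg_restrict_compose:
  assumes A: "finite A" and c: "inj_on c {1..m}" "c ` {1..m} \<subseteq> A"
  shows "pavg A (\<lambda>p. H (restrict (p \<circ> c) {1..m}))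
    = fact (card A - m) / fact (card A) * (\<Sum>j\<in>distinct_tuples m A. H j)"
proof -
  define C where "C = c ` {1..m}"
  have cardC: "card (A - C) = card A - m"
    using A c by (simp add: C_def card_Diff_subset finite_subset card_image)
  define g where "g p = restrict (p \<circ> c) {1..m}" for p :: "'a \<Rightarrow> 'a"
  have fibre: "card {p \<in> {p. p permutes A}. g p = j} = fact (card A - m)"
    if j: "j \<in> distinct_tuples m A" for j
  proof -
    have jA: "j ` {1..m} \<subseteq> A" "inj_on j {1..m}" "j \<in> extensional {1..m}"
      using j by (auto simp: distinct_tuples_def PiE_def)
    have inv: "inv_into {1..m} c (c i) = i" if "i \<in> {1..m}" for i
      using c that by simp
    have bij: "bij_betw (inv_into {1..m} c) C {1..m}"
      using c(1) by (intro bij_betw_inv_into) (simp add: C_def bij_betw_def)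
    have "inj_on (\<lambda>x. j (inv_into {1..m} c x)) C"
      using comp_inj_on[of "inv_into {1..m} c" C j] bij jA(2) by (simp add: bij_betw_def comp_def)
    moreover have "(\<lambda>x. j (inv_into {1..m} c x)) ` C \<subseteq> A"
      using bij jA(1) by (simp add: bij_betw_def image_image[symmetric])
    moreover have "C \<subseteq> A" using c by (simp add: C_def)
    ultimately obtain p0 where p0: "p0 permutes A" "\<And>x. x \<in> C \<Longrightarrow> p0 x = j (inv_into {1..m} c x)"
      by (metis ex_permutes_extending[OF A])
    have p0c: "p0 (c i) = j i" if "i \<in> {1..m}" for i
      using p0(2)[of "c i"] that inv by (simp add: C_def)
    have "{p \<in> {p. p permutes A}. g p = j} = (\<lambda>q. p0 \<circ> q) ` {q. q permutes (A - C)}"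
    proof (intro equalityI subsetI)
      fix p assume "p \<in> {p \<in> {p. p permutes A}. g p = j}"
      then have p: "p permutes A" "g p = j" by auto
      define q where "q = inv p0 \<circ> p"
      have q: "q permutes A" unfolding q_def using p p0 by (intro permutes_compose permutes_inv)
      have "q x = x" if x: "x \<in> C" for x
      proof -
        obtain i where i: "i \<in> {1..m}" "x = c i" using x by (auto simp: C_def)
        then have "p (c i) = j i" using p(2) by (auto simp: g_def)
        then show ?thesis
          using i p0c permutes_inverses(2)[OF p0(1)] by (simp add: q_def) metis
      qed
      then have "q permutes (A - C)" by (intro permutes_superset[OF q]) auto
      moreover have "p = p0 \<circ> q" using permutes_inverses(1)[OF p0(1)] by (auto simp: q_def)
      ultimately show "p \<in> (\<lambda>q. p0 \<circ> q) ` {q. q permutes (A - C)}" by blast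
    next
      fix p assume "p \<in> (\<lambda>q. p0 \<circ> q) ` {q. q permutes (A - C)}"
      then obtain q where q: "q permutes (A - C)" "p = p0 \<circ> q" by blast
      have "p permutes A"
        unfolding q(2) by (intro permutes_compose p0 permutes_subset[OF q(1)]) auto
      moreover have "g p = j"
      proof
        fix i show "g p i = j i"
          using jA(3) p0c permutes_not_in[OF q(1), of "c i"]
          by (auto simp: g_def q(2) C_def extensional_def)
      qed
      ultimately show "p \<in> {p \<in> {p. p permutes A}. g p = j}" by simp
    qed
    moreover have "inj_on (\<lambda>q. p0 \<circ> q) {q. q permutes (A - C)}"
      using permutes_inj[OF p0(1)] by (auto simp: inj_on_def fun_eq_iff inj_def)
    ultimately show ?thesis
      using A by (simp add: card_image card_permutations[OF cardC])
  qed
  have "(\<Sum>p | p permutes A. H (g p))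
      = (\<Sum>j\<in>distinct_tuples m A. \<Sum>p\<in>{p \<in> {p. p permutes A}. g p = j}. H (g p))"
  proof (rule sum.group[symmetric])
    show "g ` {p. p permutes A} \<subseteq> distinct_tuples m A"
    proof
      fix j assume "j \<in> g ` {p. p permutes A}"
      then obtain p where p: "p permutes A" "j = g p" by blast
      have "inj_on (p \<circ> c) {1..m}"
        by (intro comp_inj_on c permutes_inj_on[OF p(1)])
      then show "j \<in> distinct_tuples m A"
        unfolding distinct_tuples_def p(2) g_def
        using c(2) permutes_in_image[OF p(1)] by (simp add: inj_on_restrict_eq image_subset_iff)
    qed
  qed (use A finite_permutations in auto)
  also have "\<dots> = (\<Sum>j\<in>distinct_tuples m A. fact (card A - m) * H j)"
  proof (intro sum.cong refl)
    fix j assume j: "j \<in> distinct_tuples m A"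
    have "(\<Sum>p\<in>{p \<in> {p. p permutes A}. g p = j}. H (g p)) = (\<Sum>p\<in>{p \<in> {p. p permutes A}. g p = j}. H j)"
      by (intro sum.cong) auto
    then show "(\<Sum>p\<in>{p \<in> {p. p permutes A}. g p = j}. H (g p)) = fact (card A - m) * H j"
      by (simp only: sum_constant fibre[OF j] of_nat_fact)
  qed
  finally show ?thesis
    by (simp add: pavg_def g_def sum_distrib_left sum_divide_distrib)
qed

section \<open>Bounding the factors outside the selected rows and columns\<close>

lemma kappa_ge:
  assumes n: "\<nu> < n" "n \<le> N" and J: "J \<subseteq> {1..N}" "card J = \<nu>" and R: "R \<subseteq> {1..n}" "card R = \<nu>"
  shows "1 / ((real n - real \<nu>) * (real N - real \<nu>)) *
    (\<Sum>j\<in>{1..N} - J. \<Sum>r\<in>{1..n} - R. (cmod (z j r))\<^sup>2) \<le> kappa \<nu> N n z"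
proof -
  let ?f = "\<lambda>(J, R). \<Sum>j\<in>{1..N} - J. \<Sum>r\<in>{1..n} - R. (cmod (z j r))\<^sup>2"
  let ?X = "{\<Sum>j\<in>{1..N} - J. \<Sum>r\<in>{1..n} - R. (cmod (z j r))\<^sup>2 | J R.
       J \<subseteq> {1..N} \<and> R \<subseteq> {1..n} \<and> card J = \<nu> \<and> card R = \<nu>}"
  have "?X \<subseteq> ?f ` (Pow {1..N} \<times> Pow {1..n})" by auto
  then have "finite ?X" by (rule finite_subset) simp
  moreover have "(\<Sum>j\<in>{1..N} - J. \<Sum>r\<in>{1..n} - R. (cmod (z j r))\<^sup>2) \<in> ?X" using J R by blast
  ultimately have "(\<Sum>j\<in>{1..N} - J. \<Sum>r\<in>{1..n} - R. (cmod (z j r))\<^sup>2) \<le> Max ?X" by (rule Max_ge)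
  then show ?thesis using n unfolding kappa_def by (simp add: divide_right_mono)
qed

text \<open>Averaging over the permutations of the rows and columns outside \<open>C\<close>: the Hadamard-type bound
  treats the rows, and the Cauchy-Schwarz and Maclaurin inequalities treat the columns.\<close>

lemma pavg_prod_complement_le:
  fixes z :: "nat \<Rightarrow> nat \<Rightarrow> complex" and b :: "nat \<Rightarrow> real"
  assumes n: "n \<le> N" and C: "C \<subseteq> {1..n}"
    and S: "S \<subseteq> {1..n} - C"
    and p: "p permutes {1..N}" and \<sigma>: "\<sigma> permutes {1..n}" and b: "\<And>r. 0 \<le> b r"
  shows "pavg ({1..n} - C) (\<lambda>\<rho>. pavg ({1..N} - C) (\<lambda>q. \<Prod>l\<in>S. cmod (z (p (q l)) (\<sigma> (\<rho> l))))
      * (\<Prod>l\<in>T. b (\<sigma> (\<rho> l))))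
    \<le> sqrt (pavg ({1..n} - C) (\<lambda>\<rho>. \<Prod>l\<in>T. (b (\<sigma> (\<rho> l)))\<^sup>2)) * sqrt (kappa (card C) N n z) ^ card S"
proof -
  define A' M' where "A' = {1..N} - C" and "M' = {1..n} - C"
  have sub: "M' \<subseteq> A'" "S \<subseteq> M'" "finite A'" "finite M'" using n S by (auto simp: A'_def M'_def)
  have finC: "finite C" using C finite_subset by blast
  have cards: "card A' = N - card C" "card M' = n - card C"
    using C order_trans[OF C, of "{1..N}"] n finC by (simp_all add: A'_def M'_def card_Diff_subset)
  have cardC: "card C \<le> n" using card_mono[OF _ C] by simp
  \<comment> \<open>The root mean square of column \<open>\<sigma> r\<close> over the rows that
    remain. Its factor \<open>1 / card A'\<close> and the \<open>1 / card M'\<close> from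
    Maclaurin's inequality together give the normalisation of \<open>kappa\<close>.\<close>
  define a where "a r = sqrt ((\<Sum>j\<in>A'. (cmod (z (p j) (\<sigma> r)))\<^sup>2) / card A')" for r
  have "pavg M' (\<lambda>\<rho>. pavg A' (\<lambda>q. \<Prod>l\<in>S. cmod (z (p (q l)) (\<sigma> (\<rho> l)))) * (\<Prod>l\<in>T. b (\<sigma> (\<rho> l))))
      \<le> pavg M' (\<lambda>\<rho>. (\<Prod>l\<in>S. a (\<rho> l)) * (\<Prod>l\<in>T. b (\<sigma> (\<rho> l))))"
  proof (intro pavg_mono mult_right_mono prod_nonneg)
    fix \<rho> :: "nat \<Rightarrow> nat" assume "\<rho> permutes M'"
    show "pavg A' (\<lambda>q. \<Prod>l\<in>S. cmod (z (p (q l)) (\<sigma> (\<rho> l)))) \<le> (\<Prod>l\<in>S. a (\<rho> l))"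
      unfolding a_def using sub
      by (intro pavg_prod_le_prod_l2[where h = "\<lambda>l j. cmod (z (p j) (\<sigma> (\<rho> l)))"]) auto
  qed (simp add: b)
  also have "\<dots> \<le> sqrt (pavg M' (\<lambda>\<rho>. (\<Prod>l\<in>S. a (\<rho> l))\<^sup>2)) * sqrt (pavg M' (\<lambda>\<rho>. (\<Prod>l\<in>T. b (\<sigma> (\<rho> l)))\<^sup>2))"
    by (rule pavg_cauchy_schwarz)
  also have "\<dots> \<le> sqrt (kappa (card C) N n z ^ card S) * sqrt (pavg M' (\<lambda>\<rho>. (\<Prod>l\<in>T. b (\<sigma> (\<rho> l)))\<^sup>2))"
  proof (intro mult_right_mono real_sqrt_le_mono)
    show "pavg M' (\<lambda>\<rho>. (\<Prod>l\<in>S. a (\<rho> l))\<^sup>2) \<le> kappa (card C) N n z ^ card S"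
    \<comment> \<open>For empty \<open>S\<close> both sides are 1; otherwise a column remains
      outside \<open>C\<close>, so \<open>kappa\<close> is a genuine maximum.\<close>
    proof (cases "S = {}")
      case True
      then show ?thesis using sub by simp
    next
      case False
      then have "card M' > 0" using sub by (auto simp: card_gt_0_iff)
      then have lt: "card C < n" using cards by simp
      have "pavg M' (\<lambda>\<rho>. (\<Prod>l\<in>S. a (\<rho> l))\<^sup>2) = pavg M' (\<lambda>\<rho>. \<Prod>l\<in>S. (\<lambda>r. (a r)\<^sup>2) (\<rho> l))"
        by (simp add: prod_power_distrib)
      also have "\<dots> \<le> ((\<Sum>r\<in>M'. (a r)\<^sup>2) / card M') ^ card S"
        using sub by (intro pavg_prod_le_mean_power) auto
      also have "\<dots> \<le> kappa (card C) N n z ^ card S"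
      proof (intro power_mono)
        have "(\<Sum>r\<in>M'. (a r)\<^sup>2) / card M'
            = 1 / ((real n - real (card C)) * (real N - real (card C))) *
              (\<Sum>r\<in>M'. \<Sum>j\<in>A'. (cmod (z (p j) (\<sigma> r)))\<^sup>2)"
          using cards cardC n by (simp add: a_def sum_nonneg sum_divide_distrib[symmetric] of_nat_diff)
        also have "(\<Sum>r\<in>M'. \<Sum>j\<in>A'. (cmod (z (p j) (\<sigma> r)))\<^sup>2) = (\<Sum>j\<in>A'. \<Sum>r\<in>M'. (cmod (z (p j) (\<sigma> r)))\<^sup>2)"
          by (rule sum.swap)
        also have "\<dots> = (\<Sum>j\<in>{1..N} - p ` C. \<Sum>r\<in>M'. (cmod (z j (\<sigma> r)))\<^sup>2)"
        proof (rule sum.reindex_bij_betw)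
          show "bij_betw p A' ({1..N} - p ` C)"
            unfolding A'_def bij_betw_def using permutes_image[OF p] permutes_inj[OF p]
            by (simp add: image_set_diff inj_on_subset[OF permutes_inj[OF p]])
        qed
        also have "\<dots> = (\<Sum>j\<in>{1..N} - p ` C. \<Sum>r\<in>{1..n} - \<sigma> ` C. (cmod (z j r))\<^sup>2)"
        proof (rule sum.cong[OF refl], rule sum.reindex_bij_betw)
          show "bij_betw \<sigma> M' ({1..n} - \<sigma> ` C)"
            unfolding M'_def bij_betw_def using permutes_image[OF \<sigma>] permutes_inj[OF \<sigma>]
            by (simp add: image_set_diff inj_on_subset[OF permutes_inj[OF \<sigma>]])
        qed
        \<comment> \<open>The deleted rows and columns are the images of \<open>C\<close> under
          \<open>p\<close> and \<open>\<sigma>\<close>; the maximum removes this dependence.\<close>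
        also have "1 / ((real n - real (card C)) * (real N - real (card C))) * \<dots> \<le> kappa (card C) N n z"
        proof (rule kappa_ge[OF lt n])
          have "p ` C \<subseteq> p ` {1..N}" using C n by (intro image_mono) auto
          then show "p ` C \<subseteq> {1..N}" using permutes_image[OF p] by simp
          have "\<sigma> ` C \<subseteq> \<sigma> ` {1..n}" using C by (intro image_mono) auto
          then show "\<sigma> ` C \<subseteq> {1..n}" using permutes_image[OF \<sigma>] by simp
        qed (simp_all add: card_image permutes_inj_on[OF p] permutes_inj_on[OF \<sigma>])
        finally show "(\<Sum>r\<in>M'. (a r)\<^sup>2) / card M' \<le> kappa (card C) N n z" .
      qed (simp add: sum_nonneg)
      finally show ?thesis .
    qed
  next
    show "0 \<le> sqrt (pavg M' (\<lambda>\<rho>. (\<Prod>l\<in>T. b (\<sigma> (\<rho> l)))\<^sup>2))" by (simp add: pavg_nonneg)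
  qed
  finally show ?thesis
    by (simp add: A'_def M'_def real_sqrt_power prod_power_distrib mult.commute)
qed

text \<open>\<open>\<Phi>\<close> is the weight on the selected rows and columns, \<open>S\<close>
  the columns that keep their entries, \<open>T\<close> those replaced by means. Composing
  \<open>p\<close> and \<open>\<sigma>\<close> with permutations that fix the selected places leaves
  \<open>\<Phi>\<close> alone, so the other factors can be averaged first.\<close>

lemma pavg_pavg_weighted_prod_le:
  fixes z :: "nat \<Rightarrow> nat \<Rightarrow> complex" and \<Phi> :: "(nat \<Rightarrow> nat) \<Rightarrow> (nat \<Rightarrow> nat) \<Rightarrow> real"
  assumes n: "n \<le> N" "0 < n" and c: "inj_on c {1..\<nu>}" "c ` {1..\<nu>} \<subseteq> {1..n}"
    and S: "S \<subseteq> {1..n} - c ` {1..\<nu>}"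
    and \<Phi>: "\<And>j d. 0 \<le> \<Phi> j d"
  defines "T \<equiv> {1..n} - c ` {1..\<nu>} - S"
  shows "pavg {1..n} (\<lambda>\<sigma>. pavg {1..N} (\<lambda>p. \<Phi> (restrict (p \<circ> c) {1..\<nu>}) (restrict (\<sigma> \<circ> c) {1..\<nu>}) *
        (\<Prod>l\<in>S. cmod (z (p l) (\<sigma> l)))) * (\<Prod>l\<in>T. cmod (zmean N z (\<sigma> l))))
    \<le> fact (N - \<nu>) / fact N * sqrt (fact (n - \<nu>) / fact n) *
       sqrt (\<Sum>d\<in>distinct_tuples \<nu> {1..n}. (\<Sum>j\<in>distinct_tuples \<nu> {1..N}. \<Phi> j d)\<^sup>2) *
       (sqrt (beta N n z) ^ card T * sqrt (kappa \<nu> N n z) ^ card S)"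
proof -
  define C where "C = c ` {1..\<nu>}"
  define A M where "A = {1..N}" and "M = {1..n}"
  define A' M' where "A' = A - C" and "M' = M - C"
  have cardC: "card C = \<nu>" using c by (simp add: C_def card_image)
  have sub: "A' \<subseteq> A" "M' \<subseteq> M" "finite A" "finite M" by (auto simp: A_def M_def A'_def M'_def)
  define \<Psi> where "\<Psi> p \<sigma> = \<Phi> (restrict (p \<circ> c) {1..\<nu>}) (restrict (\<sigma> \<circ> c) {1..\<nu>})" for p \<sigma> :: "nat \<Rightarrow> nat"
  have inv: "\<Psi> (p \<circ> q) (\<sigma> \<circ> \<rho>) = \<Psi> p \<sigma>" if "q permutes A'" "\<rho> permutes M'" for p q \<sigma> \<rho>
  proof -
    have "restrict ((p \<circ> q) \<circ> c) {1..\<nu>} = restrict (p \<circ> c) {1..\<nu>}"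
      using that permutes_not_in by (fastforce simp: A'_def C_def)
    moreover have "restrict ((\<sigma> \<circ> \<rho>) \<circ> c) {1..\<nu>} = restrict (\<sigma> \<circ> c) {1..\<nu>}"
      using that permutes_not_in by (fastforce simp: M'_def C_def)
    ultimately show ?thesis by (simp add: \<Psi>_def)
  qed
  define b where "b r = cmod (zmean N z r)" for r
  define k where "k = sqrt (kappa \<nu> N n z) ^ card S"
  \<comment> \<open>\<open>sqrt\<close> is negative at negative arguments, so the sign of
    \<open>kappa\<close> matters; one admissible choice of deleted rows and columns settles
    it.\<close>
  have k: "0 \<le> k"
  proof -
    have "0 \<le> kappa \<nu> N n z" if "S \<noteq> {}"
    proof -
      have "card ({1..n} - C) > 0" using that S by (auto simp: card_gt_0_iff C_def)
      moreover have "card ({1..n} - C) = n - \<nu>"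
        using c(2) cardC by (simp add: C_def card_Diff_subset)
      ultimately have lt: "\<nu> < n" by simp
      have "0 \<le> 1 / ((real n - real \<nu>) * (real N - real \<nu>)) *
        (\<Sum>j\<in>{1..N} - {1..\<nu>}. \<Sum>r\<in>{1..n} - {1..\<nu>}. (cmod (z j r))\<^sup>2)"
        using lt n by (intro mult_nonneg_nonneg sum_nonneg) auto
      also have "\<dots> \<le> kappa \<nu> N n z" using lt n by (intro kappa_ge) auto
      finally show ?thesis .
    qed
    then show ?thesis unfolding k_def by (cases "S = {}") auto
  qed
  define w where "w \<sigma> = pavg M' (\<lambda>\<rho>. \<Prod>l\<in>T. (b (\<sigma> (\<rho> l)))\<^sup>2)" for \<sigma> :: "nat \<Rightarrow> nat"
  have "pavg M (\<lambda>\<sigma>. pavg A (\<lambda>p. \<Psi> p \<sigma> * (\<Prod>l\<in>S. cmod (z (p l) (\<sigma> l)))) * (\<Prod>l\<in>T. b (\<sigma> l)))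
      = pavg M (\<lambda>\<sigma>. pavg M' (\<lambda>\<rho>. pavg A (\<lambda>p. pavg A' (\<lambda>q. \<Psi> (p \<circ> q) (\<sigma> \<circ> \<rho>) *
          (\<Prod>l\<in>S. cmod (z ((p \<circ> q) l) ((\<sigma> \<circ> \<rho>) l))))) * (\<Prod>l\<in>T. b ((\<sigma> \<circ> \<rho>) l))))"
    by (subst pavg_refine[OF sub(4,2)], subst pavg_refine[OF sub(3,1)]) (rule refl)
  also have "\<dots> = pavg M (\<lambda>\<sigma>. pavg A (\<lambda>p. \<Psi> p \<sigma> * pavg M' (\<lambda>\<rho>. pavg A' (\<lambda>q.
          (\<Prod>l\<in>S. cmod (z (p (q l)) (\<sigma> (\<rho> l))))) * (\<Prod>l\<in>T. b (\<sigma> (\<rho> l))))))"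
  proof (rule pavg_cong)
    fix \<sigma>
    have "pavg M' (\<lambda>\<rho>. pavg A (\<lambda>p. pavg A' (\<lambda>q. \<Psi> (p \<circ> q) (\<sigma> \<circ> \<rho>) *
          (\<Prod>l\<in>S. cmod (z ((p \<circ> q) l) ((\<sigma> \<circ> \<rho>) l))))) * (\<Prod>l\<in>T. b ((\<sigma> \<circ> \<rho>) l)))
      = pavg M' (\<lambda>\<rho>. pavg A (\<lambda>p. pavg A' (\<lambda>q. \<Psi> p \<sigma> *
          (\<Prod>l\<in>S. cmod (z ((p \<circ> q) l) ((\<sigma> \<circ> \<rho>) l))))) * (\<Prod>l\<in>T. b ((\<sigma> \<circ> \<rho>) l)))"
      by (intro pavg_cong arg_cong2[where f = "(*)"] refl) (simp add: inv)
    also have "\<dots> = pavg M' (\<lambda>\<rho>. pavg A (\<lambda>p. \<Psi> p \<sigma> * (pavg A' (\<lambda>q.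
          (\<Prod>l\<in>S. cmod (z (p (q l)) (\<sigma> (\<rho> l))))) * (\<Prod>l\<in>T. b (\<sigma> (\<rho> l))))))"
      by (simp add: pavg_cmult_left pavg_cmult_right flip: mult.assoc)
    also have "\<dots> = pavg A (\<lambda>p. \<Psi> p \<sigma> * pavg M' (\<lambda>\<rho>. pavg A' (\<lambda>q.
          (\<Prod>l\<in>S. cmod (z (p (q l)) (\<sigma> (\<rho> l))))) * (\<Prod>l\<in>T. b (\<sigma> (\<rho> l)))))"
      by (subst pavg_swap) (simp add: pavg_cmult_left)
    finally show "pavg M' (\<lambda>\<rho>. pavg A (\<lambda>p. pavg A' (\<lambda>q. \<Psi> (p \<circ> q) (\<sigma> \<circ> \<rho>) *
          (\<Prod>l\<in>S. cmod (z ((p \<circ> q) l) ((\<sigma> \<circ> \<rho>) l))))) * (\<Prod>l\<in>T. b ((\<sigma> \<circ> \<rho>) l)))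
      = \<dots>" .
  qed
  also have "\<dots> \<le> pavg M (\<lambda>\<sigma>. pavg A (\<lambda>p. \<Psi> p \<sigma> * (sqrt (w \<sigma>) * k)))"
  proof (intro pavg_mono mult_left_mono)
    fix \<sigma> p assume *: "\<sigma> permutes M" "p permutes A"
    show "pavg M' (\<lambda>\<rho>. pavg A' (\<lambda>q. \<Prod>l\<in>S. cmod (z (p (q l)) (\<sigma> (\<rho> l)))) * (\<Prod>l\<in>T. b (\<sigma> (\<rho> l))))
        \<le> sqrt (w \<sigma>) * k"
      using pavg_prod_complement_le[of n N C S p \<sigma> b z T] n c S *
      unfolding w_def k_def cardC A'_def M'_def A_def M_def
      by (simp add: C_def b_def)
  qed (simp add: \<Psi>_def \<Phi>)
  also have "\<dots> = k * pavg M (\<lambda>\<sigma>. pavg A (\<lambda>p. \<Psi> p \<sigma>) * sqrt (w \<sigma>))"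
    by (simp only: pavg_cmult_right mult.assoc[symmetric]) (simp only: mult_ac)
  \<comment> \<open>The inner bound \<open>sqrt (w \<sigma>) * k\<close> is free of
    \<open>p\<close>, so only the average over \<open>\<sigma>\<close> needs Cauchy-Schwarz: the row
    averages of \<open>\<Psi>\<close> appear squared, as in \<open>theta3\<close> and
    \<open>theta4\<close>.\<close>
  also have "\<dots> \<le> k * (sqrt (pavg M (\<lambda>\<sigma>. (pavg A (\<lambda>p. \<Psi> p \<sigma>))\<^sup>2)) * sqrt (pavg M (\<lambda>\<sigma>. (sqrt (w \<sigma>))\<^sup>2)))"
  proof (intro mult_left_mono pavg_cauchy_schwarz)
    show "0 \<le> k" by (fact k)
  qed
  also have "\<dots> \<le> k * (sqrt (pavg M (\<lambda>\<sigma>. (pavg A (\<lambda>p. \<Psi> p \<sigma>))\<^sup>2)) * sqrt (beta N n z) ^ card T)"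
  proof (intro mult_left_mono)
    have "pavg M (\<lambda>\<sigma>. (sqrt (w \<sigma>))\<^sup>2) = pavg M w"
      by (intro pavg_cong real_sqrt_pow2) (simp add: w_def pavg_nonneg prod_nonneg)
    \<comment> \<open>The refinement read backwards: the averages over the columns outside
      \<open>C\<close> recombine into one over all columns.\<close>
    also have "\<dots> = pavg M (\<lambda>\<sigma>. \<Prod>l\<in>T. (b (\<sigma> l))\<^sup>2)"
      unfolding w_def by (subst (2) pavg_refine[OF sub(4,2)]) simp
    also have "\<dots> \<le> ((\<Sum>r\<in>M. (b r)\<^sup>2) / card M) ^ card T"
      by (rule pavg_prod_le_mean_power) (auto simp: M_def T_def)
    also have "(\<Sum>r\<in>M. (b r)\<^sup>2) / card M = beta N n z" by (simp add: beta_def b_def M_def)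
    finally have "sqrt (pavg M (\<lambda>\<sigma>. (sqrt (w \<sigma>))\<^sup>2)) \<le> sqrt (beta N n z ^ card T)"
      by (rule real_sqrt_le_mono)
    then show "sqrt (pavg M (\<lambda>\<sigma>. (sqrt (w \<sigma>))\<^sup>2)) \<le> sqrt (beta N n z) ^ card T"
      by (simp add: real_sqrt_power)
  next
    show "0 \<le> sqrt (pavg M (\<lambda>\<sigma>. (pavg A (\<lambda>p. \<Psi> p \<sigma>))\<^sup>2))" by (simp add: pavg_nonneg)
  qed (fact k)
  also have "pavg M (\<lambda>\<sigma>. (pavg A (\<lambda>p. \<Psi> p \<sigma>))\<^sup>2) = fact (n - \<nu>) / fact n * ((fact (N - \<nu>) / fact N)\<^sup>2 *
      (\<Sum>d\<in>distinct_tuples \<nu> {1..n}. (\<Sum>j\<in>distinct_tuples \<nu> {1..N}. \<Phi> j d)\<^sup>2))"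
  proof -
    have "c ` {1..\<nu>} \<subseteq> A" using c n by (auto simp: A_def)
    then have "pavg A (\<lambda>p. \<Psi> p \<sigma>) = fact (N - \<nu>) / fact N *
        (\<Sum>j\<in>distinct_tuples \<nu> {1..N}. \<Phi> j (restrict (\<sigma> \<circ> c) {1..\<nu>}))" for \<sigma>
      unfolding \<Psi>_def using pavg_restrict_compose[of A c \<nu> "\<lambda>j. \<Phi> j (restrict (\<sigma> \<circ> c) {1..\<nu>})"] c
      by (simp add: A_def)
    then have "pavg M (\<lambda>\<sigma>. (pavg A (\<lambda>p. \<Psi> p \<sigma>))\<^sup>2) = pavg M (\<lambda>\<sigma>. (\<lambda>d. (fact (N - \<nu>) / fact N)\<^sup>2 *
        (\<Sum>j\<in>distinct_tuples \<nu> {1..N}. \<Phi> j d)\<^sup>2) (restrict (\<sigma> \<circ> c) {1..\<nu>}))"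
      by (simp only: power_mult_distrib)
    also have "\<dots> = fact (n - \<nu>) / fact n * (\<Sum>d\<in>distinct_tuples \<nu> {1..n}. (fact (N - \<nu>) / fact N)\<^sup>2 *
        (\<Sum>j\<in>distinct_tuples \<nu> {1..N}. \<Phi> j d)\<^sup>2)"
      by (subst pavg_restrict_compose) (use c in \<open>simp_all add: M_def\<close>)
    finally show ?thesis by (simp only: sum_distrib_left)
  qed
  finally show ?thesis
    unfolding \<Psi>_def A_def M_def b_def k_def
    by (simp add: real_sqrt_mult real_sqrt_divide mult_ac)
qed

section \<open>Telescoping and exchanging rows\<close>

text \<open>The order is essential: in the term of \<open>m\<close> only the factors before
  \<open>m\<close> keep the values \<open>a\<close>, so for random entries against means only their
  rows are visible to the centred factor.\<close>

lemma prod_diff_telescope: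
  fixes a b :: "'i::linorder \<Rightarrow> 'b::comm_ring_1"
  assumes "finite S"
  shows "(\<Prod>l\<in>S. a l) - (\<Prod>l\<in>S. b l) =
    (\<Sum>m\<in>S. (\<Prod>l\<in>{l\<in>S. m < l}. b l) * ((\<Prod>l\<in>{l\<in>S. l < m}. a l) * (a m - b m)))"
  using assms
proof (induction S rule: finite_linorder_max_induct)
  case (insert x S)
  have 1: "{l \<in> insert x S. x < l} = {}" "{l \<in> insert x S. l < x} = S" using insert by auto
  have 2: "{l \<in> insert x S. m < l} = insert x {l\<in>S. m < l}" "{l \<in> insert x S. l < m} = {l\<in>S. l < m}"
    if "m \<in> S" for m using insert that by auto
  have x: "x \<notin> S" using insert by auto
  have "(\<Sum>m\<in>S. (\<Prod>l\<in>{l\<in>insert x S. m < l}. b l) * ((\<Prod>l\<in>{l\<in>insert x S. l < m}. a l) * (a m - b m)))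
      = (\<Sum>m\<in>S. b x * ((\<Prod>l\<in>{l\<in>S. m < l}. b l) * ((\<Prod>l\<in>{l\<in>S. l < m}. a l) * (a m - b m))))"
    by (intro sum.cong refl) (simp only: 2, subst prod.insert, use insert x in \<open>auto simp: mult.assoc\<close>)
  also have "\<dots> = b x * ((\<Prod>l\<in>S. a l) - (\<Prod>l\<in>S. b l))"
    by (simp only: insert.IH sum_distrib_left)
  finally have "(\<Sum>m\<in>S. (\<Prod>l\<in>{l\<in>insert x S. m < l}. b l) *
      ((\<Prod>l\<in>{l\<in>insert x S. l < m}. a l) * (a m - b m))) = b x * ((\<Prod>l\<in>S. a l) - (\<Prod>l\<in>S. b l))" .
  then show ?case
    unfolding sum.insert[OF insert.hyps(1) x] prod.insert[OF insert.hyps(1) x] 1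
    by (simp add: algebra_simps)
qed simp

text \<open>The number of smaller elements is the rank, which takes each value below
  \<open>card S\<close> once. The averaged remainder bounds depend on nothing but this rank.\<close>

lemma sum_card_less:
  fixes f :: "nat \<Rightarrow> 'b::comm_monoid_add"
  assumes "finite (S :: 'i::linorder set)"
  shows "(\<Sum>m\<in>S. f (card {l\<in>S. l < m})) = (\<Sum>s<card S. f s)"
  using assms
proof (induction S rule: finite_linorder_max_induct)
  case (insert x S)
  have 1: "{l \<in> insert x S. l < x} = S" using insert by auto
  have 2: "{l \<in> insert x S. l < m} = {l\<in>S. l < m}" if "m \<in> S" for m using insert that by auto
  have x: "x \<notin> S" using insert by auto
  have "(\<Sum>m\<in>S. f (card {l\<in>insert x S. l < m})) = (\<Sum>s<card S. f s)"
    unfolding insert.IH[symmetric] by (intro sum.cong refl) (simp only: 2)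
  then show ?case
    unfolding sum.insert[OF insert.hyps(1) x] card_insert_disjoint[OF insert.hyps(1) x] 1
    by (simp add: add.commute)
qed simp

lemma pavg_transpose:
  assumes "i \<in> A" "k \<in> A"
  shows "pavg A H = pavg A (\<lambda>p. H (p \<circ> Transposition.transpose i k))"
  using assms by (intro pavg_compose_right[symmetric] permutes_swap_id)

text \<open>The mean of \<open>x\<close> is the average of \<open>x (p i)\<close> over all
  \<open>i\<close>. For \<open>i\<close> outside \<open>R\<close>, exchanging \<open>p i\<close> and
  \<open>p k\<close> fixes \<open>G\<close> and reverses the sign of the difference, so that term
  vanishes. Centring thus gains a factor \<open>1 / card A\<close> at the price of
  \<open>card R\<close> terms.\<close>

lemma pavg_mult_centered:
  fixes x :: "'a \<Rightarrow> complex"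
  assumes A: "finite A" and R: "R \<subseteq> A" and k: "k \<in> A - R"
    and G: "\<And>p q. (\<And>l. l \<in> R \<Longrightarrow> p l = q l) \<Longrightarrow> G p = G q"
  shows "pavg A (\<lambda>p. G p * (x (p k) - (1 / of_nat (card A)) * (\<Sum>a\<in>A. x a)))
    = (1 / of_nat (card A)) * (\<Sum>i\<in>R. pavg A (\<lambda>p. G p * (x (p k) - x (p i))))"
proof -
  have N: "of_nat (card A) \<noteq> (0 :: complex)" using A k by auto
  have "pavg A (\<lambda>p. G p * (x (p k) - (1 / of_nat (card A)) * (\<Sum>a\<in>A. x a)))
      = pavg A (\<lambda>p. (1 / of_nat (card A)) * (\<Sum>i\<in>A. G p * (x (p k) - x (p i))))"
  proof (rule pavg_cong)
    fix p assume p: "p permutes A"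
    have "(\<Sum>i\<in>A. x (p i)) = (\<Sum>a\<in>A. x a)"
      using sum.permute[OF p, of x] by (simp add: comp_def)
    then have *: "(\<Sum>i\<in>A. x (p k) - x (p i)) = of_nat (card A) * x (p k) - (\<Sum>a\<in>A. x a)"
      by (simp add: sum_subtractf)
    then show "G p * (x (p k) - (1 / of_nat (card A)) * (\<Sum>a\<in>A. x a))
        = (1 / of_nat (card A)) * (\<Sum>i\<in>A. G p * (x (p k) - x (p i)))"
      using N unfolding sum_distrib_left[symmetric] * by (simp add: field_simps)
  qed
  also have "\<dots> = (1 / of_nat (card A)) * (\<Sum>i\<in>A. pavg A (\<lambda>p. G p * (x (p k) - x (p i))))"
    by (simp only: pavg_cmult_left pavg_sum)
  also have "(\<Sum>i\<in>A. pavg A (\<lambda>p. G p * (x (p k) - x (p i))))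
      = (\<Sum>i\<in>R. pavg A (\<lambda>p. G p * (x (p k) - x (p i))))"
  proof (rule sum.mono_neutral_right[OF A R], intro ballI)
    fix i assume i: "i \<in> A - R"
    have "pavg A (\<lambda>p. G p * (x (p k) - x (p i))) = pavg A (\<lambda>p. G p * (x (p i) - x (p k)))"
    proof (subst pavg_transpose[of i A k], use i k in blast, use k in blast, rule pavg_cong)
      fix p
      have "G (p \<circ> Transposition.transpose i k) = G p"
        using i k by (intro G) (auto simp: Transposition.transpose_def)
      then show "G (p \<circ> Transposition.transpose i k) *
          (x ((p \<circ> Transposition.transpose i k) k) - x ((p \<circ> Transposition.transpose i k) i))
          = G p * (x (p i) - x (p k))" by simp
    qed
    also have "\<dots> = - pavg A (\<lambda>p. G p * (x (p k) - x (p i)))"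
      by (simp add: pavg_diff right_diff_distrib)
    finally show "pavg A (\<lambda>p. G p * (x (p k) - x (p i))) = 0" by simp
  qed
  finally show ?thesis .
qed

text \<open>The average equals its version with \<open>i\<close> and \<open>k\<close> exchanged;
  half the sum of the two turns \<open>f (p i)\<close> into a difference as well.\<close>

lemma pavg_mult_diff_symmetrize:
  fixes f x :: "'a \<Rightarrow> complex"
  assumes "i \<in> A" "k \<in> A" "i \<noteq> k" and G: "\<And>p. G (p \<circ> Transposition.transpose i k) = G p"
  shows "pavg A (\<lambda>p. G p * f (p i) * (x (p k) - x (p i)))
    = - (1/2) * pavg A (\<lambda>p. G p * ((f (p i) - f (p k)) * (x (p i) - x (p k))))"
proof -
  have "pavg A (\<lambda>p. G p * f (p i) * (x (p k) - x (p i))) = pavg A (\<lambda>p. G p * f (p k) * (x (p i) - x (p k)))"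
    by (subst pavg_transpose[OF assms(1,2)]) (simp add: G)
  then have "2 * pavg A (\<lambda>p. G p * f (p i) * (x (p k) - x (p i)))
      = pavg A (\<lambda>p. G p * f (p i) * (x (p k) - x (p i))) + pavg A (\<lambda>p. G p * f (p k) * (x (p i) - x (p k)))"
    by simp
  also have "\<dots> = pavg A (\<lambda>p. (-1) * (G p * ((f (p i) - f (p k)) * (x (p i) - x (p k)))))"
    unfolding pavg_add[symmetric] by (intro pavg_cong) (simp add: algebra_simps)
  also have "\<dots> = (-1) * pavg A (\<lambda>p. G p * ((f (p i) - f (p k)) * (x (p i) - x (p k))))"
    by (rule pavg_cmult_left)
  finally show ?thesis by (simp add: field_simps)
qed

text \<open>Any two ordered pairs of distinct places are related by a permutation of
  \<open>A\<close>, so all \<open>card A * (card A - 1)\<close> of them have the same average, and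
  the diagonal contributes 0.\<close>

lemma pavg_pair:
  assumes A: "finite A" and ik: "i \<in> A" "k \<in> A" "i \<noteq> k" and \<phi>: "\<And>u. \<phi> u u = 0"
  shows "pavg A (\<lambda>p. \<phi> (p i) (p k)) =
    (1 / (of_nat (card A) * (of_nat (card A) - 1))) * (\<Sum>u\<in>A. \<Sum>v\<in>A. \<phi> u v :: 'b::real_normed_field)"
proof -
  have two: "pavg A (\<lambda>p. \<phi> (p a) (p b)) = pavg A (\<lambda>p. \<phi> (p i) (p k))"
    if ab: "a \<in> A" "b \<in> A" "a \<noteq> b" for a b
  proof -
    define f where "f x = (if x = i then a else b)" for x
    have "inj_on f {i, k}" "f ` {i, k} \<subseteq> A" using ab ik by (auto simp: f_def)
    then obtain t where t: "t permutes A" "\<And>x. x \<in> {i, k} \<Longrightarrow> t x = f x"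
      using ex_permutes_extending[OF A, of "{i, k}" f] ik by blast
    have "t i = a" "t k = b" using t(2) ik by (auto simp: f_def)
    then show ?thesis using pavg_compose_right[OF t(1), of "\<lambda>p. \<phi> (p i) (p k)"] by simp
  qed
  have "(\<Sum>u\<in>A. \<Sum>v\<in>A. \<phi> u v) = pavg A (\<lambda>p. \<Sum>u\<in>A. \<Sum>v\<in>A. \<phi> u v)" using A by simp
  also have "\<dots> = pavg A (\<lambda>p. \<Sum>a\<in>A. \<Sum>b\<in>A. \<phi> (p a) (p b))"
  proof (rule pavg_cong)
    fix p assume p: "p permutes A"
    show "(\<Sum>u\<in>A. \<Sum>v\<in>A. \<phi> u v) = (\<Sum>a\<in>A. \<Sum>b\<in>A. \<phi> (p a) (p b))"
      using sum.permute[OF p, of "\<lambda>u. \<Sum>v\<in>A. \<phi> u v"] sum.permute[OF p, of "\<phi> (p a)" for a]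
      by (simp add: comp_def)
  qed
  also have "\<dots> = (\<Sum>a\<in>A. \<Sum>b\<in>A. pavg A (\<lambda>p. \<phi> (p a) (p b)))"
    by (simp add: pavg_sum)
  also have "\<dots> = (\<Sum>a\<in>A. \<Sum>b\<in>A. if b = a then 0 else pavg A (\<lambda>p. \<phi> (p i) (p k)))"
    using A \<phi> by (intro sum.cong refl) (auto simp: two)
  also have "\<dots> = (\<Sum>a\<in>A. of_nat (card A - 1) * pavg A (\<lambda>p. \<phi> (p i) (p k)))"
  proof (rule sum.cong[OF refl])
    fix a assume a: "a \<in> A"
    show "(\<Sum>b\<in>A. if b = a then 0 else pavg A (\<lambda>p. \<phi> (p i) (p k)))
        = of_nat (card A - 1) * pavg A (\<lambda>p. \<phi> (p i) (p k))"
      using A a by (simp add: sum.remove)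
  qed
  also have "\<dots> = of_nat (card A) * (of_nat (card A) - 1) * pavg A (\<lambda>p. \<phi> (p i) (p k))"
    using A ik by (subst of_nat_diff) (auto simp: card_gt_0_iff Suc_le_eq mult.assoc)
  finally have eq: "(\<Sum>u\<in>A. \<Sum>v\<in>A. \<phi> u v) = \<dots>" .
  have "card {i, k} \<le> card A" using A ik by (intro card_mono) auto
  then have "of_nat (card A) \<noteq> (0 :: 'b)" "of_nat (card A) \<noteq> (1 :: 'b)"
    using ik by (auto simp: of_nat_eq_1_iff)
  then show ?thesis using eq by (simp add: field_simps)
qed

text \<open>Covariance as a mean of products of differences: after centring the columns the cross
  terms sum to 0, and two equal diagonal terms remain.\<close>

lemma sum_sum_ydiff:
  assumes "1 \<le> N"
  shows "(\<Sum>u\<in>{1..N}. \<Sum>v\<in>{1..N}. ydiff z u v i * ydiff z u v k)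
    = 2 * of_nat N * (\<Sum>j\<in>{1..N}. (z j i - zmean N z i) * (z j k - zmean N z k))"
proof -
  define w where "w r j = z j r - zmean N z r" for r j
  have w0: "(\<Sum>j\<in>{1..N}. w r j) = 0" for r
    using assms by (simp add: w_def sum_subtractf zmean_def)
  have "(\<Sum>u\<in>{1..N}. \<Sum>v\<in>{1..N}. ydiff z u v i * ydiff z u v k)
      = (\<Sum>u\<in>{1..N}. \<Sum>v\<in>{1..N}. w i u * w k u - w i u * w k v - w k u * w i v + w i v * w k v)"
    by (intro sum.cong refl) (simp add: ydiff_def w_def algebra_simps)
  also have "\<dots> = of_nat N * (\<Sum>u\<in>{1..N}. w i u * w k u) + of_nat N * (\<Sum>v\<in>{1..N}. w i v * w k v)"
    by (simp add: sum.distrib sum_subtractf sum_distrib_left[symmetric] w0[unfolded One_nat_def])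
  finally show ?thesis by (simp add: w_def)
qed

section \<open>The second-order expansion\<close>

text \<open>Columns and places share labels: column \<open>l\<close> is read at row
  \<open>p l\<close>. Row \<open>p a\<close> is common to all three differences, as in
  \<open>theta3\<close>, so the order of \<open>a\<close> and \<open>b\<close> matters.
  \<open>U\<close> holds the columns whose entries have not been replaced by means.\<close>

definition rem3 :: "nat \<Rightarrow> nat \<Rightarrow> (nat \<Rightarrow> nat \<Rightarrow> complex) \<Rightarrow> nat \<Rightarrow> nat \<Rightarrow> nat \<Rightarrow> nat set \<Rightarrow> real" where
  "rem3 N n z a b c U =
    pavg {1..N} (\<lambda>p. cmod (ydiff z (p a) (p b) a * ydiff z (p a) (p b) b * ydiff z (p a) (p c) c) *
      (\<Prod>l\<in>U. cmod (z (p l) l))) * (\<Prod>l\<in>{1..n} - {a, b, c} - U. cmod (zmean N z l))"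

definition rem4 :: "nat \<Rightarrow> nat \<Rightarrow> (nat \<Rightarrow> nat \<Rightarrow> complex) \<Rightarrow> nat \<Rightarrow> nat \<Rightarrow> nat \<Rightarrow> nat \<Rightarrow> nat set \<Rightarrow> real" where
  "rem4 N n z a b c d U =
    pavg {1..N} (\<lambda>p. cmod (ydiff z (p a) (p b) a * ydiff z (p a) (p b) b *
        ydiff z (p c) (p d) c * ydiff z (p c) (p d) d) *
      (\<Prod>l\<in>U. cmod (z (p l) l))) * (\<Prod>l\<in>{1..n} - {a, b, c, d} - U. cmod (zmean N z l))"

lemma zmean_permute_columns: "zmean N (\<lambda>j r. z j (\<sigma> r)) r = zmean N z (\<sigma> r)"
  by (simp add: zmean_def)

lemma ydiff_permute_columns: "ydiff (\<lambda>j r. z j (\<sigma> r)) u v r = ydiff z u v (\<sigma> r)"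
  by (simp add: ydiff_def)

lemma pavg_rem3_le:
  assumes n: "n \<le> N" and abc: "a \<in> {1..n}" "b \<in> {1..n}" "c \<in> {1..n}" "a \<noteq> b" "a \<noteq> c" "b \<noteq> c"
    and U: "U \<subseteq> {1..n} - {a, b, c}"
  shows "pavg {1..n} (\<lambda>\<sigma>. rem3 N n (\<lambda>j r. z j (\<sigma> r)) a b c U)
    \<le> theta3 N n z * (sqrt (beta N n z) ^ (n - 3 - card U) * sqrt (kappa 3 N n z) ^ card U)"
proof -
  define t where "t = (\<lambda>x :: nat. if x = 1 then a else if x = 2 then b else c)"
  have ran: "{1..3} = {1, 2, 3 :: nat}" by auto
  have inj: "inj_on t {1..3}" and im: "t ` {1..3} = {a, b, c}"
    unfolding ran t_def inj_on_def using abc by auto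
  have t: "t (Suc 0) = a" "t 2 = b" "t 3 = c" by (simp_all add: t_def)
  have "card {a, b, c} \<le> card {1..n}" using abc by (intro card_mono) auto
  then have n3: "3 \<le> n" using abc by simp
  have "card ({1..n} - {a, b, c}) = n - 3"
    using abc by (subst card_Diff_subset) auto
  moreover have "finite U" using U finite_subset by blast
  ultimately have "card ({1..n} - {a, b, c} - U) = n - 3 - card U"
    using card_Diff_subset[OF _ U] by simp
  moreover have "0 < n" "t ` {1..3} \<subseteq> {1..n}" "U \<subseteq> {1..n} - t ` {1..3}"
    using n3 im abc U by auto
  note pavg_pavg_weighted_prod_le[OF n(1) this(1) inj this(2,3),
      of "\<lambda>j c. cmod (ydiff z (j 1) (j 2) (c 1) *
        ydiff z (j 1) (j 2) (c 2) * ydiff z (j 1) (j 3) (c 3))" z]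
  ultimately show ?thesis
    using n3 unfolding rem3_def theta3_def im
    by (simp add: zmean_permute_columns ydiff_permute_columns t)
qed

lemma pavg_rem4_le:
  assumes n: "n \<le> N" and abcd: "a \<in> {1..n}" "b \<in> {1..n}" "c \<in> {1..n}" "d \<in> {1..n}"
      "a \<noteq> b" "a \<noteq> c" "a \<noteq> d" "b \<noteq> c" "b \<noteq> d" "c \<noteq> d"
    and U: "U \<subseteq> {1..n} - {a, b, c, d}"
  shows "pavg {1..n} (\<lambda>\<sigma>. rem4 N n (\<lambda>j r. z j (\<sigma> r)) a b c d U)
    \<le> theta4 N n z * (sqrt (beta N n z) ^ (n - 4 - card U) * sqrt (kappa 4 N n z) ^ card U)"
proof -
  define t where "t = (\<lambda>x :: nat. if x = 1 then a else if x = 2 then b else if x = 3 then c else d)"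
  have ran: "{1..4} = {1, 2, 3, 4 :: nat}" by auto
  have inj: "inj_on t {1..4}" and im: "t ` {1..4} = {a, b, c, d}"
    unfolding ran t_def inj_on_def using abcd by auto
  have t: "t (Suc 0) = a" "t 2 = b" "t 3 = c" "t 4 = d" by (simp_all add: t_def)
  have "card {a, b, c, d} \<le> card {1..n}" using abcd by (intro card_mono) auto
  then have n4: "4 \<le> n" using abcd by simp
  have "card ({1..n} - {a, b, c, d}) = n - 4"
    using abcd by (subst card_Diff_subset) auto
  moreover have "finite U" using U finite_subset by blast
  ultimately have "card ({1..n} - {a, b, c, d} - U) = n - 4 - card U"
    using card_Diff_subset[OF _ U] by simp
  moreover have "0 < n" "t ` {1..4} \<subseteq> {1..n}" "U \<subseteq> {1..n} - t ` {1..4}"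
    using n4 im abcd U by auto
  note pavg_pavg_weighted_prod_le[OF n(1) this(1) inj this(2,3),
      of "\<lambda>j c. cmod (ydiff z (j 1) (j 2) (c 1) *
        ydiff z (j 1) (j 2) (c 2) * ydiff z (j 3) (j 4) (c 3) * ydiff z (j 3) (j 4) (c 4))" z]
  ultimately show ?thesis
    using n4 unfolding rem4_def theta4_def im
    by (simp add: zmean_permute_columns ydiff_permute_columns t)
qed

section \<open>The two telescoping steps\<close>

lemma zmean_alt: "zmean N z r = (1 / of_nat (card {1..N})) * (\<Sum>j\<in>{1..N}. z j r)"
  by (simp add: zmean_def)

text \<open>Centring column \<open>k\<close> leaves the exchanges with \<open>i < k\<close>. The
  factor \<open>z (p i) i\<close> is present, so symmetrisation makes it a difference. The constant
  is \<open>1/N\<close> from centring times \<open>-1/2\<close> from symmetrising.\<close>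

lemma pavg_prod_expansion:
  assumes n: "n \<le> N"
  shows "pavg {1..N} (\<lambda>p. \<Prod>l\<in>{1..n}. z (p l) l) - (\<Prod>l\<in>{1..n}. zmean N z l) =
    - (1 / (2 * of_nat N)) * (\<Sum>k\<in>{1..n}. \<Sum>i\<in>{1..<k}. (\<Prod>l\<in>{k<..n}. zmean N z l) *
      pavg {1..N} (\<lambda>p. (ydiff z (p i) (p k) i * ydiff z (p i) (p k) k) * (\<Prod>l\<in>{1..<k} - {i}. z (p l) l)))"
proof -
  let ?E = "pavg {1..N} :: ((nat \<Rightarrow> nat) \<Rightarrow> complex) \<Rightarrow> complex"
  have "?E (\<lambda>p. \<Prod>l\<in>{1..n}. z (p l) l) - (\<Prod>l\<in>{1..n}. zmean N z l)
      = ?E (\<lambda>p. (\<Prod>l\<in>{1..n}. z (p l) l) - (\<Prod>l\<in>{1..n}. zmean N z l))"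
    by (simp add: pavg_diff)
  also have "\<dots> = ?E (\<lambda>p. \<Sum>k\<in>{1..n}. (\<Prod>l\<in>{k<..n}. zmean N z l) *
      ((\<Prod>l\<in>{1..<k}. z (p l) l) * (z (p k) k - zmean N z k)))"
  proof (rule pavg_cong)
    fix p
    have "{l \<in> {1..n}. k < l} = {k<..n}" "{l \<in> {1..n}. l < k} = {1..<k}" if "k \<in> {1..n}" for k
      using that by auto
    then show "(\<Prod>l\<in>{1..n}. z (p l) l) - (\<Prod>l\<in>{1..n}. zmean N z l) =
      (\<Sum>k\<in>{1..n}. (\<Prod>l\<in>{k<..n}. zmean N z l) *
        ((\<Prod>l\<in>{1..<k}. z (p l) l) * (z (p k) k - zmean N z k)))"
      by (subst prod_diff_telescope) (auto intro!: sum.cong)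
  qed
  also have "\<dots> = (\<Sum>k\<in>{1..n}. (\<Prod>l\<in>{k<..n}. zmean N z l) *
      ?E (\<lambda>p. (\<Prod>l\<in>{1..<k}. z (p l) l) * (z (p k) k - zmean N z k)))"
    by (simp only: pavg_sum pavg_cmult_left)
  also have "\<dots> = (\<Sum>k\<in>{1..n}. (\<Prod>l\<in>{k<..n}. zmean N z l) * ((- (1 / (2 * of_nat N))) * (\<Sum>i\<in>{1..<k}.
      ?E (\<lambda>p. (ydiff z (p i) (p k) i * ydiff z (p i) (p k) k) * (\<Prod>l\<in>{1..<k} - {i}. z (p l) l)))))"
  proof (intro sum.cong refl arg_cong2[where f = "(*)"])
    fix k assume k: "k \<in> {1..n}"
    have "{1..<k} \<subseteq> {1..N}" using k n by auto
    then have "?E (\<lambda>p. (\<Prod>l\<in>{1..<k}. z (p l) l) * (z (p k) k - zmean N z k)) =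
        (1 / of_nat N) * (\<Sum>i\<in>{1..<k}. ?E (\<lambda>p. (\<Prod>l\<in>{1..<k}. z (p l) l) * (z (p k) k - z (p i) k)))"
      using pavg_mult_centered[of "{1..N}" "{1..<k}" k "\<lambda>p. \<Prod>l\<in>{1..<k}. z (p l) l" "\<lambda>a. z a k"] k n
      unfolding zmean_alt by simp
    also have "(\<Sum>i\<in>{1..<k}. ?E (\<lambda>p. (\<Prod>l\<in>{1..<k}. z (p l) l) * (z (p k) k - z (p i) k))) =
       (\<Sum>i\<in>{1..<k}. - (1/2) *
      ?E (\<lambda>p. (ydiff z (p i) (p k) i * ydiff z (p i) (p k) k) * (\<Prod>l\<in>{1..<k} - {i}. z (p l) l)))"
    proof (rule sum.cong[OF refl])
      fix i assume i: "i \<in> {1..<k}"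
      define G where "G p = (\<Prod>l\<in>{1..<k} - {i}. z (p l) l)" for p
      have "(\<Prod>l\<in>{1..<k}. z (p l) l) = G p * z (p i) i" for p
        using i by (simp add: G_def prod.remove mult.commute)
      then have "?E (\<lambda>p. (\<Prod>l\<in>{1..<k}. z (p l) l) * (z (p k) k - z (p i) k))
          = ?E (\<lambda>p. G p * z (p i) i * (z (p k) k - z (p i) k))" by simp
      also have "\<dots> = - (1/2) * ?E (\<lambda>p. G p * ((z (p i) i - z (p k) i) * (z (p i) k - z (p k) k)))"
      proof (rule pavg_mult_diff_symmetrize[where f = "\<lambda>a. z a i" and x = "\<lambda>a. z a k"])
        show "G (p \<circ> Transposition.transpose i k) = G p" for p
          unfolding G_def by (intro prod.cong) (auto simp: Transposition.transpose_def)
      qed (use i k n in auto)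
      also have "\<dots> = - (1/2) *
      ?E (\<lambda>p. (ydiff z (p i) (p k) i * ydiff z (p i) (p k) k) * (\<Prod>l\<in>{1..<k} - {i}. z (p l) l))"
        by (simp add: G_def ydiff_def mult.commute)
      finally show "?E (\<lambda>p. (\<Prod>l\<in>{1..<k}. z (p l) l) * (z (p k) k - z (p i) k)) = \<dots>" .
    qed
    finally show "?E (\<lambda>p. (\<Prod>l\<in>{1..<k}. z (p l) l) * (z (p k) k - zmean N z k)) =
       (- (1 / (2 * of_nat N))) * (\<Sum>i\<in>{1..<k}.
      ?E (\<lambda>p. (ydiff z (p i) (p k) i * ydiff z (p i) (p k) k) * (\<Prod>l\<in>{1..<k} - {i}. z (p l) l)))"
      by (simp add: sum_distrib_left[symmetric] sum_negf sum_divide_distrib[symmetric])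
  qed
  also have "\<dots> = - (1 / (2 * of_nat N)) * (\<Sum>k\<in>{1..n}. \<Sum>i\<in>{1..<k}. (\<Prod>l\<in>{k<..n}. zmean N z l) *
      ?E (\<lambda>p. (ydiff z (p i) (p k) i * ydiff z (p i) (p k) k) * (\<Prod>l\<in>{1..<k} - {i}. z (p l) l)))"
    by (simp only: sum_distrib_left mult.left_commute)
  finally show ?thesis .
qed

text \<open>The centred column \<open>m\<close> interacts with the rows visible next to it: those of
  \<open>i\<close> and \<open>k\<close> give one three-row remainder each, and every element of
  \<open>U m\<close> gives a four-row remainder.\<close>

lemma norm_pavg_pair_diff_le:
  fixes z :: "nat \<Rightarrow> nat \<Rightarrow> complex"
  assumes n: "n \<le> N" and k: "k \<in> {1..n}" and i: "i \<in> {1..<k}"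
  defines "S \<equiv> {1..<k} - {i}"
  defines "Y \<equiv> \<lambda>p. ydiff z (p i) (p k) i * ydiff z (p i) (p k) k"
  defines "U \<equiv> \<lambda>m. {l \<in> S. l < m}"
  shows "cmod ((\<Prod>l\<in>{k<..n}. zmean N z l) * (pavg {1..N} (\<lambda>p. Y p * (\<Prod>l\<in>S. z (p l) l))
      - (\<Prod>l\<in>S. zmean N z l) * pavg {1..N} Y))
    \<le> (1 / real N) * (\<Sum>m\<in>S. rem3 N n z i k m (U m) + rem3 N n z k i m (U m) +
        (1/2) * (\<Sum>l\<in>U m. rem4 N n z i k l m (U m - {l})))"
proof -
  let ?E = "pavg {1..N} :: ((nat \<Rightarrow> nat) \<Rightarrow> complex) \<Rightarrow> complex"
  define P where "P m = (\<Prod>l\<in>{1..n} - {i, k, m} - U m. cmod (zmean N z l))" for m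
  have finS: "finite S" by (simp add: S_def)
  have "?E (\<lambda>p. Y p * (\<Prod>l\<in>S. z (p l) l)) - (\<Prod>l\<in>S. zmean N z l) * ?E Y
      = ?E (\<lambda>p. Y p * ((\<Prod>l\<in>S. z (p l) l) - (\<Prod>l\<in>S. zmean N z l)))"
    by (simp add: right_diff_distrib pavg_diff pavg_cmult_right mult.commute)
  also have "\<dots> = ?E (\<lambda>p. \<Sum>m\<in>S. (\<Prod>l\<in>{l\<in>S. m < l}. zmean N z l) *
      (Y p * (\<Prod>l\<in>U m. z (p l) l) * (z (p m) m - zmean N z m)))"
    unfolding prod_diff_telescope[OF finS] U_def sum_distrib_left by (simp add: mult_ac)
  also have "\<dots> = (\<Sum>m\<in>S. (\<Prod>l\<in>{l\<in>S. m < l}. zmean N z l) *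
      ?E (\<lambda>p. Y p * (\<Prod>l\<in>U m. z (p l) l) * (z (p m) m - zmean N z m)))"
    by (simp only: pavg_sum pavg_cmult_left)
  finally have "cmod ((\<Prod>l\<in>{k<..n}. zmean N z l) * (?E (\<lambda>p. Y p * (\<Prod>l\<in>S. z (p l) l))
      - (\<Prod>l\<in>S. zmean N z l) * ?E Y))
    = cmod (\<Sum>m\<in>S. (\<Prod>l\<in>{k<..n}. zmean N z l) * (\<Prod>l\<in>{l\<in>S. m < l}. zmean N z l) *
      ?E (\<lambda>p. Y p * (\<Prod>l\<in>U m. z (p l) l) * (z (p m) m - zmean N z m)))"
    by (simp add: sum_distrib_left mult.assoc)
  also have "\<dots> \<le> (\<Sum>m\<in>S. cmod ((\<Prod>l\<in>{k<..n}. zmean N z l) * (\<Prod>l\<in>{l\<in>S. m < l}. zmean N z l) *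
      ?E (\<lambda>p. Y p * (\<Prod>l\<in>U m. z (p l) l) * (z (p m) m - zmean N z m))))"
    by (rule norm_sum)
  also have "\<dots> \<le> (\<Sum>m\<in>S. (1 / real N) * (rem3 N n z i k m (U m) + rem3 N n z k i m (U m) +
        (1/2) * (\<Sum>l\<in>U m. rem4 N n z i k l m (U m - {l}))))"
  proof (rule sum_mono)
    fix m assume m: "m \<in> S"
    have mm: "1 \<le> m" "m < k" "m \<noteq> i" using m by (auto simp: S_def)
    have iU: "i \<notin> U m" "k \<notin> U m" "m \<notin> U m" "finite (U m)" by (auto simp: U_def S_def)
    have Usub: "U m \<subseteq> {1..n}" using k by (auto simp: U_def S_def)
    define D where "D j = ?E (\<lambda>p. Y p * (\<Prod>l\<in>U m. z (p l) l) * (z (p m) m - z (p j) m))" for j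
    have "{1..n} - {i, k, m} - U m = {k<..n} \<union> {l\<in>S. m < l}"
      using i k mm by (auto simp: U_def S_def)
    moreover have "{k<..n} \<inter> {l\<in>S. m < l} = {}" by (auto simp: S_def)
    ultimately have P: "cmod ((\<Prod>l\<in>{k<..n}. zmean N z l) * (\<Prod>l\<in>{l\<in>S. m < l}. zmean N z l)) = P m"
      using finS by (simp add: P_def prod.union_disjoint norm_mult prod_norm)
    have Pnn: "0 \<le> P m" by (simp add: P_def prod_nonneg)
    have "?E (\<lambda>p. Y p * (\<Prod>l\<in>U m. z (p l) l) * (z (p m) m - zmean N z m))
        = (1 / of_nat N) * (\<Sum>j\<in>{i, k} \<union> U m. D j)"
    proof -
      have "Y p * (\<Prod>l\<in>U m. z (p l) l) = Y q * (\<Prod>l\<in>U m. z (q l) l)"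
        if "\<And>l. l \<in> {i, k} \<union> U m \<Longrightarrow> p l = q l" for p q
        using that by (simp add: Y_def)
      moreover have "{i, k} \<union> U m \<subseteq> {1..N}" "m \<in> {1..N} - ({i, k} \<union> U m)"
        using k i mm iU n Usub by auto
      ultimately show ?thesis
        using pavg_mult_centered[of "{1..N}" "{i, k} \<union> U m" m
            "\<lambda>p. Y p * (\<Prod>l\<in>U m. z (p l) l)" "\<lambda>a. z a m"]
        unfolding zmean_alt D_def by simp
    qed
    also have "(\<Sum>j\<in>{i, k} \<union> U m. D j) = D i + D k + (\<Sum>l\<in>U m. D l)"
      using i iU by (subst sum.union_disjoint) auto
    finally have "cmod (?E (\<lambda>p. Y p * (\<Prod>l\<in>U m. z (p l) l) * (z (p m) m - zmean N z m)))
        = (1 / real N) * cmod (D i + D k + (\<Sum>l\<in>U m. D l))"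
      by (simp add: norm_mult norm_divide)
    also have "\<dots> \<le> (1 / real N) * (cmod (D i) + cmod (D k) + (\<Sum>l\<in>U m. cmod (D l)))"
      by (intro mult_left_mono norm_triangle_le add_mono norm_sum norm_triangle_ineq) auto
    finally have 1: "cmod (?E (\<lambda>p. Y p * (\<Prod>l\<in>U m. z (p l) l) * (z (p m) m - zmean N z m)))
        \<le> (1 / real N) * (cmod (D i) + cmod (D k) + (\<Sum>l\<in>U m. cmod (D l)))" .
    \<comment> \<open>Exchanging \<open>p i\<close> and \<open>p m\<close> would alter
      \<open>Y\<close>, so nothing is symmetrised and no factor 1/2 arises; the centred difference
      itself is the third factor.\<close>
    have Di: "P m * cmod (D i) \<le> rem3 N n z i k m (U m)"
    proof -
      have "cmod (D i) \<le> pavg {1..N} (\<lambda>p. cmod (Y p * (\<Prod>l\<in>U m. z (p l) l) * (z (p m) m - z (p i) m)))"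
        unfolding D_def by (rule norm_pavg_le)
      also have "\<dots> = pavg {1..N} (\<lambda>p. cmod (ydiff z (p i) (p k) i * ydiff z (p i) (p k) k * ydiff z (p i) (p m) m) *
        (\<Prod>l\<in>U m. cmod (z (p l) l)))"
        by (intro pavg_cong) (simp add: Y_def ydiff_def norm_mult prod_norm norm_minus_commute)
      finally show ?thesis
        unfolding rem3_def P_def[symmetric] by (simp add: mult.commute mult_left_mono Pnn)
    qed
    have Dk: "P m * cmod (D k) \<le> rem3 N n z k i m (U m)"
    proof -
      have "cmod (D k) \<le> pavg {1..N} (\<lambda>p. cmod (Y p * (\<Prod>l\<in>U m. z (p l) l) * (z (p m) m - z (p k) m)))"
        unfolding D_def by (rule norm_pavg_le)
      also have "\<dots> = pavg {1..N} (\<lambda>p. cmod (ydiff z (p k) (p i) k * ydiff z (p k) (p i) i * ydiff z (p k) (p m) m) *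
        (\<Prod>l\<in>U m. cmod (z (p l) l)))"
        by (intro pavg_cong) (simp add: Y_def ydiff_def norm_mult prod_norm norm_minus_commute)
      finally show ?thesis
        unfolding rem3_def insert_commute[of k i] P_def[symmetric]
        by (simp add: mult.commute mult_left_mono Pnn)
    qed
    \<comment> \<open>\<open>Y\<close> ignores the rows \<open>p l\<close> and \<open>p m\<close>,
      so symmetrisation is available. It creates the second pair of differences and the factor 1/2,
      and it uses up the entry of column \<open>l\<close>.\<close>
    have Dl: "P m * cmod (D l) \<le> (1/2) * rem4 N n z i k l m (U m - {l})" if l: "l \<in> U m" for l
    proof -
      have ll: "1 \<le> l" "l < m" "l \<noteq> i" "l \<noteq> k" using l mm by (auto simp: U_def S_def)
      define G where "G p = Y p * (\<Prod>l\<in>U m - {l}. z (p l) l)" for p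
      have "(\<Prod>l\<in>U m. z (p l) l) = (\<Prod>l\<in>U m - {l}. z (p l) l) * z (p l) l" for p
        using l iU by (simp add: prod.remove mult.commute)
      then have "D l = ?E (\<lambda>p. G p * z (p l) l * (z (p m) m - z (p l) m))"
        by (simp add: D_def G_def mult.assoc)
      also have "\<dots> = - (1/2) * ?E (\<lambda>p. G p * ((z (p l) l - z (p m) l) * (z (p l) m - z (p m) m)))"
      proof (rule pavg_mult_diff_symmetrize[where f = "\<lambda>a. z a l" and x = "\<lambda>a. z a m"])
        show "G (p \<circ> Transposition.transpose l m) = G p" for p
          unfolding G_def Y_def using ll mm iU i
          by (intro arg_cong2[where f = "(*)"] prod.cong) (auto simp: Transposition.transpose_def)
      qed (use ll mm k n in auto)
      finally have "cmod (D l) = (1/2) * cmod (?E (\<lambda>p. G p * ((z (p l) l - z (p m) l) * (z (p l) m - z (p m) m))))"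
        by (simp add: norm_mult)
      also have "\<dots> \<le> (1/2) * pavg {1..N} (\<lambda>p. cmod (G p * ((z (p l) l - z (p m) l) * (z (p l) m - z (p m) m))))"
        by (intro mult_left_mono norm_pavg_le) simp
      also have "pavg {1..N} (\<lambda>p. cmod (G p * ((z (p l) l - z (p m) l) * (z (p l) m - z (p m) m))))
          = pavg {1..N} (\<lambda>p. cmod (ydiff z (p i) (p k) i * ydiff z (p i) (p k) k *
              ydiff z (p l) (p m) l * ydiff z (p l) (p m) m) * (\<Prod>l\<in>U m - {l}. cmod (z (p l) l)))"
        by (intro pavg_cong) (simp add: G_def Y_def ydiff_def norm_mult prod_norm)
      finally have *: "cmod (D l) \<le> (1/2) * \<dots>" .
      have "{1..n} - {i, k, l, m} - (U m - {l}) = {1..n} - {i, k, m} - U m" using l by auto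
      then show ?thesis
        unfolding rem4_def using mult_left_mono[OF * Pnn] by (simp add: P_def mult_ac)
    qed
    have "cmod ((\<Prod>l\<in>{k<..n}. zmean N z l) * (\<Prod>l\<in>{l\<in>S. m < l}. zmean N z l) *
      ?E (\<lambda>p. Y p * (\<Prod>l\<in>U m. z (p l) l) * (z (p m) m - zmean N z m)))
      \<le> P m * ((1 / real N) * (cmod (D i) + cmod (D k) + (\<Sum>l\<in>U m. cmod (D l))))"
      unfolding norm_mult[of "_ * _"] P by (intro mult_left_mono 1 Pnn)
    also have "\<dots> = (1 / real N) * (P m * cmod (D i) + P m * cmod (D k) + (\<Sum>l\<in>U m. P m * cmod (D l)))"
      by (simp add: sum_distrib_left[symmetric] ring_distribs)
    also have "\<dots> \<le> (1 / real N) * (rem3 N n z i k m (U m) + rem3 N n z k i m (U m) +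
        (\<Sum>l\<in>U m. (1/2) * rem4 N n z i k l m (U m - {l})))"
      by (intro mult_left_mono add_mono sum_mono Di Dk Dl) auto
    finally show "cmod ((\<Prod>l\<in>{k<..n}. zmean N z l) * (\<Prod>l\<in>{l\<in>S. m < l}. zmean N z l) *
      ?E (\<lambda>p. Y p * (\<Prod>l\<in>U m. z (p l) l) * (z (p m) m - zmean N z m)))
      \<le> (1 / real N) * (rem3 N n z i k m (U m) + rem3 N n z k i m (U m) +
        (1/2) * (\<Sum>l\<in>U m. rem4 N n z i k l m (U m - {l})))"
      by (simp only: sum_distrib_left)
  qed
  finally show ?thesis by (simp only: sum_distrib_left)
qed

lemma sum_subsets_card_2:
  fixes F :: "nat set \<Rightarrow> 'b::comm_monoid_add"
  shows "(\<Sum>R\<in>{R. R \<subseteq> {1..n} \<and> card R = 2}. F R) = (\<Sum>k\<in>{1..n}. \<Sum>i\<in>{1..<k}. F {i, k})"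
proof -
  have "(\<Sum>k\<in>{1..n}. \<Sum>i\<in>{1..<k}. F {i, k}) = (\<Sum>(k, i)\<in>(SIGMA k:{1..n}. {1..<k}). F {i, k})"
    by (rule sum.Sigma) auto
  also have "\<dots> = (\<Sum>R\<in>{R. R \<subseteq> {1..n} \<and> card R = 2}. F R)"
  proof (rule sum.reindex_bij_witness[where i = "\<lambda>R. (Max R, Min R)" and j = "\<lambda>(k, i). {i, k}"])
    fix R assume "R \<in> {R. R \<subseteq> {1..n} \<and> card R = 2}"
    then obtain a b where ab: "R = {a, b}" "a \<noteq> b" "a \<in> {1..n}" "b \<in> {1..n}"
      by (auto simp: card_2_iff)
    then show "(case (Max R, Min R) of (k, i) \<Rightarrow> {i, k}) = R"
      by (auto simp: max_def min_def)
    show "(Max R, Min R) \<in> (SIGMA k:{1..n}. {1..<k})"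
      using ab by (auto simp: max_def min_def)
  qed (auto simp: max_def min_def)
  finally show ?thesis by simp
qed

section \<open>Counting the remainders\<close>

definition rem_sum :: "nat \<Rightarrow> nat \<Rightarrow> (nat \<Rightarrow> nat \<Rightarrow> complex) \<Rightarrow> nat \<Rightarrow> nat \<Rightarrow> nat \<Rightarrow> nat set \<Rightarrow> real" where
  "rem_sum N n z i k m U = rem3 N n z i k m U + rem3 N n z k i m U +
     (1/2) * (\<Sum>l\<in>U. rem4 N n z i k l m (U - {l}))"

text \<open>The pair average is \<open>2 * N / (N * (N - 1))\<close> times the sum in
  \<open>p2\<close>, and the prefactor \<open>1 / (2 * N)\<close> of the first telescoping cancels
  the \<open>2 * N\<close>.\<close>

lemma p2_eq_sum_pavg:
  assumes n: "n \<le> N" "2 \<le> N"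
  shows "p2 N n z / (of_nat N * (of_nat N - 1)) =
    (1 / (2 * of_nat N)) * (\<Sum>k\<in>{1..n}. \<Sum>i\<in>{1..<k}. (\<Prod>l\<in>{k<..n}. zmean N z l) *
      ((\<Prod>l\<in>{1..<k} - {i}. zmean N z l) * pavg {1..N} (\<lambda>p. ydiff z (p i) (p k) i * ydiff z (p i) (p k) k)))"
proof -
  define c :: complex where "c = of_nat N * (of_nat N - 1)"
  have N0: "of_nat N \<noteq> (0 :: complex)" using n by simp
  have "(1 / (2 * of_nat N)) * ((\<Prod>l\<in>{k<..n}. zmean N z l) *
      ((\<Prod>l\<in>{1..<k} - {i}. zmean N z l) * pavg {1..N} (\<lambda>p. ydiff z (p i) (p k) i * ydiff z (p i) (p k) k)))
    = (pmean N z ({1..n} - {i, k}) * (\<Sum>j\<in>{1..N}. \<Prod>r\<in>{i, k}. z j r - zmean N z r)) / c"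
    if k: "k \<in> {1..n}" and i: "i \<in> {1..<k}" for i k
  proof -
    have "{1..n} - {i, k} = {k<..n} \<union> ({1..<k} - {i})" using k i by auto
    moreover have "{k<..n} \<inter> ({1..<k} - {i}) = {}" by auto
    ultimately have 1: "pmean N z ({1..n} - {i, k}) = (\<Prod>l\<in>{k<..n}. zmean N z l) * (\<Prod>l\<in>{1..<k} - {i}. zmean N z l)"
      by (simp add: pmean_def prod.union_disjoint)
    have "pavg {1..N} (\<lambda>p. ydiff z (p i) (p k) i * ydiff z (p i) (p k) k)
        = (1 / c) * (\<Sum>u\<in>{1..N}. \<Sum>v\<in>{1..N}. ydiff z u v i * ydiff z u v k)"
      using pavg_pair[of "{1..N}" i k "\<lambda>u v. ydiff z u v i * ydiff z u v k"] k i n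
      by (simp add: ydiff_def c_def)
    also have "\<dots> = (1 / c) * (2 * of_nat N * (\<Sum>j\<in>{1..N}. (z j i - zmean N z i) * (z j k - zmean N z k)))"
      using n by (subst sum_sum_ydiff) auto
    also have "(\<Sum>j\<in>{1..N}. (z j i - zmean N z i) * (z j k - zmean N z k))
        = (\<Sum>j\<in>{1..N}. \<Prod>r\<in>{i, k}. z j r - zmean N z r)"
      using i by simp
    finally show ?thesis using N0 unfolding 1 by simp
  qed
  then have "(\<Sum>k\<in>{1..n}. \<Sum>i\<in>{1..<k}. (1 / (2 * of_nat N)) * ((\<Prod>l\<in>{k<..n}. zmean N z l) *
      ((\<Prod>l\<in>{1..<k} - {i}. zmean N z l) * pavg {1..N} (\<lambda>p. ydiff z (p i) (p k) i * ydiff z (p i) (p k) k))))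
    = (\<Sum>k\<in>{1..n}. \<Sum>i\<in>{1..<k}.
        (pmean N z ({1..n} - {i, k}) * (\<Sum>j\<in>{1..N}. \<Prod>r\<in>{i, k}. z j r - zmean N z r)) / c)"
    by (intro sum.cong refl) blast
  also have "\<dots> = p2 N n z / c"
    by (simp only: p2_def sum_subsets_card_2 sum_divide_distrib)
  finally show ?thesis by (simp only: c_def sum_distrib_left)
qed

text \<open>Adding \<open>p2\<close> cancels the terms in which all factors beside the pair are
  means, so only the differences treated by the second telescoping survive. The constant is
  \<open>1 / (2 * N)\<close> times \<open>1 / N\<close>.\<close>

lemma norm_expansion_le:
  assumes n: "n \<le> N" "2 \<le> N"
  shows "cmod (pavg {1..N} (\<lambda>p. \<Prod>l\<in>{1..n}. z (p l) l) - (\<Prod>l\<in>{1..n}. zmean N z l)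
      + p2 N n z / (of_nat N * (of_nat N - 1)))
    \<le> 1 / (2 * (real N)\<^sup>2) * (\<Sum>k\<in>{1..n}. \<Sum>i\<in>{1..<k}. \<Sum>m\<in>{1..<k} - {i}.
        rem_sum N n z i k m {l \<in> {1..<k} - {i}. l < m})"
proof -
  define X where "X k i = (\<Prod>l\<in>{k<..n}. zmean N z l) *
      (pavg {1..N} (\<lambda>p. (ydiff z (p i) (p k) i * ydiff z (p i) (p k) k) * (\<Prod>l\<in>{1..<k} - {i}. z (p l) l))
      - (\<Prod>l\<in>{1..<k} - {i}. zmean N z l) * pavg {1..N} (\<lambda>p. ydiff z (p i) (p k) i * ydiff z (p i) (p k) k))"
    for k i
  have "pavg {1..N} (\<lambda>p. \<Prod>l\<in>{1..n}. z (p l) l) - (\<Prod>l\<in>{1..n}. zmean N z l)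
      + p2 N n z / (of_nat N * (of_nat N - 1)) = - (1 / (2 * of_nat N)) * (\<Sum>k\<in>{1..n}. \<Sum>i\<in>{1..<k}. X k i)"
    unfolding pavg_prod_expansion[OF n(1)] p2_eq_sum_pavg[OF n] X_def
    by (simp add: right_diff_distrib sum_subtractf)
  then have "cmod (pavg {1..N} (\<lambda>p. \<Prod>l\<in>{1..n}. z (p l) l) - (\<Prod>l\<in>{1..n}. zmean N z l)
      + p2 N n z / (of_nat N * (of_nat N - 1))) = 1 / (2 * real N) * cmod (\<Sum>k\<in>{1..n}. \<Sum>i\<in>{1..<k}. X k i)"
    by (simp add: norm_mult norm_divide)
  also have "\<dots> \<le> 1 / (2 * real N) * (\<Sum>k\<in>{1..n}. \<Sum>i\<in>{1..<k}. cmod (X k i))"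
    by (intro mult_left_mono order_trans[OF norm_sum] sum_mono norm_sum) auto
  also have "\<dots> \<le> 1 / (2 * real N) * (\<Sum>k\<in>{1..n}. \<Sum>i\<in>{1..<k}. (1 / real N) *
      (\<Sum>m\<in>{1..<k} - {i}. rem_sum N n z i k m {l \<in> {1..<k} - {i}. l < m}))"
    unfolding X_def rem_sum_def
    by (intro mult_left_mono sum_mono norm_pavg_pair_diff_le n) auto
  also have "\<dots> = 1 / (2 * (real N)\<^sup>2) * (\<Sum>k\<in>{1..n}. \<Sum>i\<in>{1..<k}. \<Sum>m\<in>{1..<k} - {i}.
        rem_sum N n z i k m {l \<in> {1..<k} - {i}. l < m})"
    unfolding sum_distrib_left[symmetric] by (simp add: power2_eq_square)
  finally show ?thesis .
qed

lemma pavg_rem_sum_le: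
  assumes n: "n \<le> N" and k: "k \<in> {1..n}" and i: "i \<in> {1..<k}" and m: "m \<in> {1..<k} - {i}"
    and U: "U \<subseteq> {1..<m} - {i}"
  shows "pavg {1..n} (\<lambda>\<sigma>. rem_sum N n (\<lambda>j r. z j (\<sigma> r)) i k m U)
    \<le> 2 * (theta3 N n z * (sqrt (beta N n z) ^ (n - 3 - card U) * sqrt (kappa 3 N n z) ^ card U)) +
      (1/2) * (real (card U) * (theta4 N n z *
        (sqrt (beta N n z) ^ (n - 3 - card U) * sqrt (kappa 4 N n z) ^ (card U - 1))))"
proof -
  have "finite U" using U finite_subset by blast
  have "(\<Sum>l\<in>U. pavg {1..n} (\<lambda>\<sigma>. rem4 N n (\<lambda>j r. z j (\<sigma> r)) i k l m (U - {l})))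
      \<le> (\<Sum>l\<in>U. theta4 N n z * (sqrt (beta N n z) ^ (n - 3 - card U) * sqrt (kappa 4 N n z) ^ (card U - 1)))"
  proof (rule sum_mono)
    fix l assume l: "l \<in> U"
    \<comment> \<open>Column \<open>l\<close> has joined the selected columns: the exponent of
      \<open>kappa\<close> drops by one, while that of \<open>beta\<close> stays
      \<open>n - 3 - card U\<close>. Truncated subtraction respects this because \<open>U\<close> is
      nonempty.\<close>
    have "0 < card U" using l \<open>finite U\<close> by (auto simp: card_gt_0_iff)
    then have "n - 4 - card (U - {l}) = n - 3 - card U" "card (U - {l}) = card U - 1"
      using l by simp_all
    moreover have "U - {l} \<subseteq> {1..n} - {i, k, l, m}" using U k i m by auto
    moreover have "l \<in> {1..n}" "i \<noteq> l" "k \<noteq> l" "l \<noteq> m" using l U k i m by auto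
    ultimately show "pavg {1..n} (\<lambda>\<sigma>. rem4 N n (\<lambda>j r. z j (\<sigma> r)) i k l m (U - {l}))
      \<le> theta4 N n z * (sqrt (beta N n z) ^ (n - 3 - card U) * sqrt (kappa 4 N n z) ^ (card U - 1))"
      using pavg_rem4_le[of n N i k l m "U - {l}" z] n k i m by simp
  qed
  then have 4: "pavg {1..n} (\<lambda>\<sigma>. \<Sum>l\<in>U. rem4 N n (\<lambda>j r. z j (\<sigma> r)) i k l m (U - {l}))
      \<le> real (card U) * (theta4 N n z *
        (sqrt (beta N n z) ^ (n - 3 - card U) * sqrt (kappa 4 N n z) ^ (card U - 1)))"
    by (simp add: pavg_sum)
  have "U \<subseteq> {1..n} - {i, k, m}" "U \<subseteq> {1..n} - {k, i, m}" using U k i m by auto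
  then have "pavg {1..n} (\<lambda>\<sigma>. rem3 N n (\<lambda>j r. z j (\<sigma> r)) i k m U)
      \<le> theta3 N n z * (sqrt (beta N n z) ^ (n - 3 - card U) * sqrt (kappa 3 N n z) ^ card U)"
    "pavg {1..n} (\<lambda>\<sigma>. rem3 N n (\<lambda>j r. z j (\<sigma> r)) k i m U)
      \<le> theta3 N n z * (sqrt (beta N n z) ^ (n - 3 - card U) * sqrt (kappa 3 N n z) ^ card U)"
    using pavg_rem3_le[of n N i k m U z] pavg_rem3_le[of n N k i m U z] n k i m by auto
  then show ?thesis
    unfolding rem_sum_def pavg_add pavg_cmult_left using 4 by linarith
qed

text \<open>After exchanging the sums, \<open>h s\<close> occurs for \<open>k\<close> from
  \<open>s + 3\<close> to \<open>n\<close>, and the sum of \<open>k - 1\<close> over this range is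
  the stated coefficient. With \<open>s = k - 3\<close> it is half the coefficient in
  \<open>f_poly\<close>.\<close>

lemma sum_pred_mult_sum_eq:
  fixes h :: "nat \<Rightarrow> real"
  shows "(\<Sum>k\<in>{1..n}. (real k - 1) * (\<Sum>s<k - 2. h s)) =
    (\<Sum>s<n - 2. h s * ((real n + real s + 1) * (real n - real s - 2) / 2))"
proof (induction n)
  case (Suc n)
  show ?case
  proof (cases "n < 2")
    case True
    then have "n = 0 \<or> n = 1" by auto
    then show ?thesis by auto
  next
    case False
    then obtain q where q: "n = q + 2" by (metis add.commute le_Suc_ex not_less)
    have "(\<Sum>k\<in>{1..Suc n}. (real k - 1) * (\<Sum>s<k - 2. h s)) =
        (\<Sum>s<q. h s * ((real n + real s + 1) * (real n - real s - 2) / 2)) + real n * (\<Sum>s<Suc q. h s)"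
      using Suc.IH by (simp add: q)
    also have "\<dots> = (\<Sum>s<q. h s * ((real n + real s + 1) * (real n - real s - 2) / 2) + real n * h s) + real n * h q"
      by (simp add: sum.distrib sum_distrib_left distrib_left)
    also have "\<dots> = (\<Sum>s<q. h s * ((real (Suc n) + real s + 1) * (real (Suc n) - real s - 2) / 2)) + real n * h q"
      by (intro arg_cong2[where f = "(+)"] sum.cong refl) (simp add: field_simps)
    also have "\<dots> = (\<Sum>s<Suc n - 2. h s * ((real (Suc n) + real s + 1) * (real (Suc n) - real s - 2) / 2))"
      by (simp add: q field_simps)
    finally show ?thesis .
  qed
qed simp

lemma f_poly_eq:
  "f_poly n x1 x2 = (\<Sum>s<n - 2. (real n + real s + 1) * (real n - real s - 2) * (x1 ^ (n - 3 - s) * x2 ^ s))"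
  unfolding f_poly_def
  by (rule sum.reindex_bij_witness[where i = "\<lambda>s. s + 3" and j = "\<lambda>k. k - 3"])
     (auto simp: of_nat_diff algebra_simps)

lemma g_poly_eq:
  "g_poly n x1 x2 = (\<Sum>s<n - 2. real s * ((real n + real s + 1) * (real n - real s - 2)) * (x1 ^ (n - 3 - s) * x2 ^ (s - 1)))"
proof -
  have "g_poly n x1 x2 = (\<Sum>s\<in>{1..<n - 2}. real s * ((real n + real s + 1) * (real n - real s - 2)) * (x1 ^ (n - 3 - s) * x2 ^ (s - 1)))"
    unfolding g_poly_def
    by (rule sum.reindex_bij_witness[where i = "\<lambda>s. s + 3" and j = "\<lambda>k. k - 3"])
       (auto simp: of_nat_diff algebra_simps)
  \<comment> \<open>The added term \<open>s = 0\<close> has coefficient 0, so the truncated exponent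
    \<open>s - 1\<close> does no harm.\<close>
  also have "\<dots> = (\<Sum>s<n - 2. real s * ((real n + real s + 1) * (real n - real s - 2)) * (x1 ^ (n - 3 - s) * x2 ^ (s - 1)))"
    by (rule sum.mono_neutral_left) auto
  finally show ?thesis .
qed

section \<open>Invariance under permutations of the columns\<close>

lemma p2_permute_columns:
  assumes \<sigma>: "\<sigma> permutes {1..n}"
  shows "p2 N n (\<lambda>j r. z j (\<sigma> r)) = p2 N n z"
proof -
  let ?F = "\<lambda>R. pmean N z ({1..n} - R) * (\<Sum>j\<in>{1..N}. \<Prod>r\<in>R. z j r - zmean N z r)"
  have inj: "inj_on \<sigma> R" for R using permutes_inj_on[OF \<sigma>] .
  have "p2 N n (\<lambda>j r. z j (\<sigma> r)) = (\<Sum>R\<in>{R. R \<subseteq> {1..n} \<and> card R = 2}. ?F (\<sigma> ` R))"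
    unfolding p2_def
  proof (rule sum.cong[OF refl])
    fix R assume "R \<in> {R. R \<subseteq> {1..n} \<and> card R = 2}"
    have "{1..n} - \<sigma> ` R = \<sigma> ` ({1..n} - R)"
      using permutes_image[OF \<sigma>] permutes_inj[OF \<sigma>] by (simp add: image_set_diff)
    then show "pmean N (\<lambda>j r. z j (\<sigma> r)) ({1..n} - R) *
        (\<Sum>j\<in>{1..N}. \<Prod>r\<in>R. z j (\<sigma> r) - zmean N (\<lambda>j r. z j (\<sigma> r)) r) = ?F (\<sigma> ` R)"
      by (simp add: pmean_def zmean_permute_columns prod.reindex[OF inj])
  qed
  also have "\<dots> = p2 N n z"
    unfolding p2_def
  proof (rule sum.reindex_bij_witness[where i = "\<lambda>R. inv \<sigma> ` R" and j = "\<lambda>R. \<sigma> ` R"])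
    fix R assume "R \<in> {R. R \<subseteq> {1..n} \<and> card R = 2}"
    then have R: "R \<subseteq> {1..n}" "card R = 2" by auto
    have i: "inv \<sigma> permutes {1..n}" using \<sigma> by (rule permutes_inv)
    show "inv \<sigma> ` \<sigma> ` R = R" "\<sigma> ` inv \<sigma> ` R = R"
      by (simp_all add: image_image permutes_inverses[OF \<sigma>])
    show "\<sigma> ` R \<in> {R. R \<subseteq> {1..n} \<and> card R = 2}"
      using R permutes_in_image[OF \<sigma>] by (auto simp: card_image[OF inj])
    show "inv \<sigma> ` R \<in> {R. R \<subseteq> {1..n} \<and> card R = 2}"
      using R permutes_in_image[OF i] by (auto simp: card_image[OF permutes_inj_on[OF i]])
  qed simp_all
  finally show ?thesis .
qed

text \<open>As \<open>n \<le> N\<close>, a permutation of the columns also permutes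
  \<open>{1..N}\<close> and can be absorbed into \<open>p\<close>.\<close>

lemma pavg_prod_permute_columns:
  fixes n N :: nat
  assumes n: "n \<le> N" and \<sigma>: "\<sigma> permutes {1..n}"
  shows "pavg {1..N} (\<lambda>p. \<Prod>l\<in>{1..n}. z (p l) (\<sigma> l)) = pavg {1..N} (\<lambda>p. \<Prod>l\<in>{1..n}. z (p l) l)"
proof -
  have "\<sigma> permutes {1..N}" by (rule permutes_subset[OF \<sigma>]) (use n in auto)
  then have "pavg {1..N} (\<lambda>p. \<Prod>l\<in>{1..n}. z (p l) l) = pavg {1..N} (\<lambda>p. \<Prod>l\<in>{1..n}. z ((p \<circ> inv \<sigma>) l) l)"
    by (intro pavg_compose_right[symmetric] permutes_inv)
  also have "\<dots> = pavg {1..N} (\<lambda>p. \<Prod>l\<in>{1..n}. z (p l) (\<sigma> l))"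
  proof (rule pavg_cong)
    fix p
    show "(\<Prod>l\<in>{1..n}. z ((p \<circ> inv \<sigma>) l) l) = (\<Prod>l\<in>{1..n}. z (p l) (\<sigma> l))"
      by (subst prod.permute[OF \<sigma>]) (simp add: permutes_inverses[OF \<sigma>] comp_def)
  qed
  finally show ?thesis by simp
qed

lemma Per_eq_pavg:
  assumes "n \<le> N"
  shows "fact (N - n) / fact N * Per N n z = pavg {1..N} (\<lambda>p. \<Prod>l\<in>{1..n}. z (p l) l)"
  using pavg_restrict_compose[of "{1..N}" id n "\<lambda>j. \<Prod>l\<in>{1..n}. z (j l) l"] assms
  by (simp add: Per_def)

theorem theorem4p10:
  fixes N n :: nat and z :: "nat \<Rightarrow> nat \<Rightarrow> complex"
  assumes "2 \<le> n" and "n \<le> N"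
  shows "cmod (fact (N - n) / fact N * Per N n z - (\<Prod>r\<in>{1..n}. zmean N z r)
             + p2 N n z / (of_nat N * (of_nat N - 1)))
      \<le> theta3 N n z / (2 * (real N)\<^sup>2) * f_poly n (sqrt (beta N n z)) (sqrt (kappa 3 N n z))
       + theta4 N n z / (8 * (real N)\<^sup>2) * g_poly n (sqrt (beta N n z)) (sqrt (kappa 4 N n z))"
    (is "?lhs \<le> ?rhs")
proof -
  have N: "n \<le> N" "2 \<le> N" using assms by auto
  define x1 x3 x4 where "x1 = sqrt (beta N n z)" and "x3 = sqrt (kappa 3 N n z)" and "x4 = sqrt (kappa 4 N n z)"
  \<comment> \<open>The bound for the column average of \<open>rem_sum\<close> when its last
    argument has \<open>s\<close> elements.\<close>
  define h where "h s = 2 * (theta3 N n z * (x1 ^ (n - 3 - s) * x3 ^ s)) +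
    (1/2) * (real s * (theta4 N n z * (x1 ^ (n - 3 - s) * x4 ^ (s - 1))))" for s
  have "?lhs \<le> 1 / (2 * (real N)\<^sup>2) * (\<Sum>k\<in>{1..n}. \<Sum>i\<in>{1..<k}. \<Sum>m\<in>{1..<k} - {i}.
      rem_sum N n (\<lambda>j r. z j (\<sigma> r)) i k m {l \<in> {1..<k} - {i}. l < m})"
    if \<sigma>: "\<sigma> permutes {1..n}" for \<sigma>
  proof -
    have "(\<Prod>r\<in>{1..n}. zmean N z (\<sigma> r)) = (\<Prod>r\<in>{1..n}. zmean N z r)"
      using prod.permute[OF \<sigma>, of "zmean N z"] by (simp add: comp_def)
    then show ?thesis
      using norm_expansion_le[OF N, of "\<lambda>j r. z j (\<sigma> r)"]
      unfolding Per_eq_pavg[OF N(1)] pavg_prod_permute_columns[OF N(1) \<sigma>]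
        p2_permute_columns[OF \<sigma>] zmean_permute_columns by simp
  qed
  then have "pavg {1..n} (\<lambda>\<sigma>. ?lhs) \<le> pavg {1..n} (\<lambda>\<sigma>. 1 / (2 * (real N)\<^sup>2) *
      (\<Sum>k\<in>{1..n}. \<Sum>i\<in>{1..<k}. \<Sum>m\<in>{1..<k} - {i}.
        rem_sum N n (\<lambda>j r. z j (\<sigma> r)) i k m {l \<in> {1..<k} - {i}. l < m}))"
    by (rule pavg_mono)
  then have "?lhs \<le> 1 / (2 * (real N)\<^sup>2) * (\<Sum>k\<in>{1..n}. \<Sum>i\<in>{1..<k}. \<Sum>m\<in>{1..<k} - {i}.
      pavg {1..n} (\<lambda>\<sigma>. rem_sum N n (\<lambda>j r. z j (\<sigma> r)) i k m {l \<in> {1..<k} - {i}. l < m}))"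
    unfolding pavg_cmult_left pavg_sum by simp
  also have "\<dots> \<le> 1 / (2 * (real N)\<^sup>2) * (\<Sum>k\<in>{1..n}. \<Sum>i\<in>{1..<k}. \<Sum>m\<in>{1..<k} - {i}.
      h (card {l \<in> {1..<k} - {i}. l < m}))"
    unfolding h_def x1_def x3_def x4_def
    by (intro mult_left_mono sum_mono pavg_rem_sum_le N) auto
  also have "(\<Sum>k\<in>{1..n}. \<Sum>i\<in>{1..<k}. \<Sum>m\<in>{1..<k} - {i}. h (card {l \<in> {1..<k} - {i}. l < m}))
      = (\<Sum>k\<in>{1..n}. (real k - 1) * (\<Sum>s<k - 2. h s))"
  proof (rule sum.cong[OF refl])
    fix k assume k: "k \<in> {1..n}"
    have "(\<Sum>i\<in>{1..<k}. \<Sum>m\<in>{1..<k} - {i}. h (card {l \<in> {1..<k} - {i}. l < m}))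
        = (\<Sum>i\<in>{1..<k}. \<Sum>s<k - 2. h s)"
    proof (rule sum.cong[OF refl])
      fix i assume "i \<in> {1..<k}"
      then have "card ({1..<k} - {i}) = k - 2" by simp
      then show "(\<Sum>m\<in>{1..<k} - {i}. h (card {l \<in> {1..<k} - {i}. l < m})) = (\<Sum>s<k - 2. h s)"
        using sum_card_less[of "{1..<k} - {i}" h] by simp
    qed
    then show "(\<Sum>i\<in>{1..<k}. \<Sum>m\<in>{1..<k} - {i}. h (card {l \<in> {1..<k} - {i}. l < m}))
        = (real k - 1) * (\<Sum>s<k - 2. h s)"
      using k by (simp add: of_nat_diff)
  qed
  also have "\<dots> = (\<Sum>s<n - 2. h s * ((real n + real s + 1) * (real n - real s - 2) / 2))"
    by (rule sum_pred_mult_sum_eq)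
  \<comment> \<open>The 1/2 from counting cancels the 2 before \<open>theta3\<close> and turns the
    1/2 before \<open>theta4\<close> into 1/4; the prefactor \<open>1 / (2 * N^2)\<close> then
    yields the denominators with 2 and 8.\<close>
  also have "\<dots> = theta3 N n z * f_poly n x1 x3 + theta4 N n z / 4 * g_poly n x1 x4"
    unfolding f_poly_eq g_poly_eq sum_distrib_left sum.distrib[symmetric] h_def
    by (intro sum.cong refl) (simp add: field_simps)
  also have "1 / (2 * (real N)\<^sup>2) * \<dots> = ?rhs"
    by (simp add: x1_def x3_def x4_def distrib_left)
  finally show ?thesis .
qed

end
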